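(* Let $(\overline M,\overline J,\overline g,\overline{\widetilde g})$ be a $2n$-dimensional almost complex manifold with Norden metric and let $M$ be an $m$-dimensional submanifold of $\overline M$, with induced tensor fields $g=\overline g|_{TM}$ and $\widetilde g=\overline{\widetilde g}|_{TM}$. Then the submanifold $(M,g)$ is generic if and only if $(M,\widetilde g)$ is a coisotropic Radical transversal lightlike submanifold of $\overline M$ (with respect to $\overline{\widetilde g}$).
   Context: An almost complex manifold with Norden metric is a $2n$-dimensional manifold $\overline M$ with an almost complex structure $\overline J$ ($\overline J^2=-\mathrm{Id}$) and a metric $\overline g$ such that $\overline g(\overline JX,\overline JY)=-\overline g(X,Y)$ for all vector fields $X,Y$. The associated metric is $\overline{\widetilde g}(X,Y)=\overline g(\overline JX,Y)$; it is also a Norden metric, and both metrics have signature $(n,n)$. CR-submanifold: $(M,g)$ is a CR-submanifold if $g$ is non-degenerate on $TM$ and $M$ is endowed with two complementary distributions $D$, $D^\bot$ of $TM$, orthogonal with respect to $g$, such that for all $x\in M$: $\overline J(D_x)=D_x$ and $\overline J(D^\bot_x)\subset T_xM^\bot$, where $TM^\bot$ is the normal bundle of $M$ with respect to $\overline g$. A CR-submanifold is called generic if $\dim D^\bot=\mathrm{codim}\,M=2n-m$. Lightlike submanifolds with respect to $\overline{\widetilde g}$: let $TM^{\widetilde\bot}$ be the normal bundle of $M$ with respect to $\overline{\widetilde g}$, and $\mathrm{Rad}\,T_xM=T_xM\cap T_xM^{\widetilde\bot}$. $(M,\widetilde g)$ is $r$-lightlike ($r>0$) if $x\mapsto \mathrm{Rad}\,T_xM$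 defines a smooth distribution $\mathrm{Rad}\,TM$ of rank $r$. It is coisotropic if $1\le r=\mathrm{codim}\,M<\dim M$, i.e. $1\le r=2n-m<m$; then $\mathrm{Rad}\,TM=TM^{\widetilde\bot}$ and the screen transversal bundle $S(TM^{\widetilde\bot})$ (a complement of $\mathrm{Rad}\,TM$ in $TM^{\widetilde\bot}$) is $\{0\}$. A screen distribution $S(TM)$ is a complement of $\mathrm{Rad}\,TM$ in $TM$. In the coisotropic case a lightlike transversal bundle $\mathrm{ltr}(TM)$ is a complement of $\mathrm{Rad}\,TM$ in the $\overline{\widetilde g}$-orthogonal complement of $S(TM)$ in $T\overline M|_M$ that is totally null for $\overline{\widetilde g}$. $(M,\widetilde g)$ is a Radical transversal lightlike submanifold if, for some choice of $S(TM)$ and $\mathrm{ltr}(TM)$, $\overline J(\mathrm{Rad}\,TM)=\mathrm{ltr}(TM)$ and $\overline J(S(TM))=S(TM)$.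
   Formalization: Both distributions D and D^⊥ of a CR-submanifold are required to have positive rank; otherwise the claim fails for open submanifolds (D^⊥ = 0, Rad TM = 0) and for totally real ones with m = n (D = 0, Rad TM = TM), which are generic but not coisotropic. *)

theory Defs
  imports "HOL-Analysis.Analysis" "HOL-Library.Function_Algebras"
begin

text \<open>
  Tangent vectors are represented by their components in all charts, i.e. by functions from charts
  to the model space. The following instance makes \<^term>\<open>span\<close>, \<^term>\<open>independent\<close> and \<^term>\<open>dim\<close>
  available for them.
\<close>

instantiation "fun" :: (type, real_vector) real_vector
begin

definition scaleR_fun :: "real \<Rightarrow> ('a \<Rightarrow> 'b) \<Rightarrow> 'a \<Rightarrow> 'b"
  where "scaleR_fun r f = (\<lambda>x. r *\<^sub>R f x)"

instance
  by standard (auto simp: scaleR_fun_def fun_eq_iff algebra_simps)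

end


section \<open>Smooth manifolds\<close>

text \<open>\<open>C^k\<close> maps on an open set: all iterated directional derivatives up to order \<open>k\<close> exist (in the
  sense of Frechet differentiability) and are continuous.\<close>

fun Ck_on :: "nat \<Rightarrow> 'e set \<Rightarrow> ('e::euclidean_space \<Rightarrow> 'f::real_normed_vector) \<Rightarrow> bool"
  where
    "Ck_on 0 S f \<longleftrightarrow> continuous_on S f"
  | "Ck_on (Suc k) S f \<longleftrightarrow>
       (\<forall>x\<in>S. f differentiable (at x)) \<and> (\<forall>v. Ck_on k S (\<lambda>x. frechet_derivative f (at x) v))"

definition smooth_on :: "'e set \<Rightarrow> ('e::euclidean_space \<Rightarrow> 'f::real_normed_vector) \<Rightarrow> bool"
  where "smooth_on S f \<longleftrightarrow> (\<forall>k. Ck_on k S f)"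

text \<open>A chart is a pair \<open>(U, \<phi>)\<close> of its domain and its coordinate map; values of \<open>\<phi>\<close> outside \<open>U\<close>
  are irrelevant.\<close>

type_synonym ('a, 'e) chart = "'a set \<times> ('a \<Rightarrow> 'e)"

record ('a, 'e) manifold =
  mtop :: "'a topology"
  atlas :: "('a, 'e) chart set"

abbreviation points :: "('a, 'e) manifold \<Rightarrow> 'a set"
  where "points M \<equiv> topspace (mtop M)"

definition charts_at :: "('a, 'e) manifold \<Rightarrow> 'a \<Rightarrow> ('a, 'e) chart set"
  where "charts_at M p = {c \<in> atlas M. p \<in> fst c}"

text \<open>The map \<open>\<phi>' \<circ> \<phi>\<inverse>\<close> on \<open>\<phi> ` (U \<inter> U')\<close>. For charts of one manifold it is the change of coordinates;
  for a chart of a submanifold and a chart of the ambient manifold it is the coordinate expression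
  of the inclusion.\<close>

definition transition :: "('a, 'e) chart \<Rightarrow> ('a, 'f) chart \<Rightarrow> 'e \<Rightarrow> 'f"
  where "transition c c' = snd c' \<circ> inv_into (fst c) (snd c)"

definition smooth_manifold :: "('a, 'e::euclidean_space) manifold \<Rightarrow> bool"
  where "smooth_manifold M \<longleftrightarrow>
    points M \<noteq> {} \<and> Hausdorff_space (mtop M) \<and> second_countable (mtop M) \<and>
    (\<Union>c\<in>atlas M. fst c) = points M \<and>
    (\<forall>(U, \<phi>) \<in> atlas M. openin (mtop M) U \<and> open (\<phi> ` U) \<and>
       homeomorphic_map (subtopology (mtop M) U) (top_of_set (\<phi> ` U)) \<phi>) \<and>
    (\<forall>c\<in>atlas M. \<forall>c'\<in>atlas M. smooth_on (snd c ` (fst c \<inter> fst c')) (transition c c'))"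


section \<open>Tangent spaces and tensor fields\<close>

text \<open>A tangent vector at \<open>p\<close> assigns to every chart at \<open>p\<close> a vector of the model space, and these
  components are related by the derivatives of the coordinate changes. Components in charts not
  containing \<open>p\<close> are set to \<open>0\<close>.\<close>

type_synonym ('a, 'e) tvec = "('a, 'e) chart \<Rightarrow> 'e"

definition tangent_space :: "('a, 'e::euclidean_space) manifold \<Rightarrow> 'a \<Rightarrow> ('a, 'e) tvec set"
  where "tangent_space M p =
    {v. (\<forall>c. c \<notin> charts_at M p \<longrightarrow> v c = 0) \<and>
        (\<forall>c\<in>charts_at M p. \<forall>c'\<in>charts_at M p.
           v c' = frechet_derivative (transition c c') (at (snd c p)) (v c))}"

text \<open>The tangent vector at \<open>p\<close> whose component in the chart \<open>c\<close> is \<open>e\<close>; for fixed basis vectors \<open>e\<close>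
  these are the coordinate vector fields of \<open>c\<close>.\<close>

definition coord_vec ::
    "('a, 'e::euclidean_space) manifold \<Rightarrow> ('a, 'e) chart \<Rightarrow> 'a \<Rightarrow> 'e \<Rightarrow> ('a, 'e) tvec"
  where "coord_vec M c p e =
    (\<lambda>c'. if c' \<in> charts_at M p then frechet_derivative (transition c c') (at (snd c p)) e else 0)"

text \<open>Fields of endomorphisms and of bilinear forms matter only on points and tangent vectors of the
  manifold. Smoothness means smoothness of all components in all charts.\<close>

definition smooth_endomorphism_field ::
    "('a, 'e::euclidean_space) manifold \<Rightarrow> ('a \<Rightarrow> ('a, 'e) tvec \<Rightarrow> ('a, 'e) tvec) \<Rightarrow> bool"
  where "smooth_endomorphism_field M J \<longleftrightarrow>
    (\<forall>p\<in>points M. \<forall>u\<in>tangent_space M p. J p u \<in> tangent_space M p \<and>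
       (\<forall>v\<in>tangent_space M p. J p (u + v) = J p u + J p v) \<and>
       (\<forall>a. J p (a *\<^sub>R u) = a *\<^sub>R J p u)) \<and>
    (\<forall>c\<in>atlas M. \<forall>e. smooth_on (snd c ` fst c)
       (\<lambda>y. let p = inv_into (fst c) (snd c) y in J p (coord_vec M c p e) c))"

definition smooth_symmetric_form_field ::
    "('a, 'e::euclidean_space) manifold \<Rightarrow> ('a \<Rightarrow> ('a, 'e) tvec \<Rightarrow> ('a, 'e) tvec \<Rightarrow> real) \<Rightarrow> bool"
  where "smooth_symmetric_form_field M g \<longleftrightarrow>
    (\<forall>p\<in>points M. \<forall>u\<in>tangent_space M p. \<forall>v\<in>tangent_space M p.
       g p u v = g p v u \<and>
       (\<forall>w\<in>tangent_space M p. g p (u + v) w = g p u w + g p v w) \<and>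
       (\<forall>a. g p (a *\<^sub>R u) v = a * g p u v)) \<and>
    (\<forall>c\<in>atlas M. \<forall>e e'. smooth_on (snd c ` fst c)
       (\<lambda>y. let p = inv_into (fst c) (snd c) y in g p (coord_vec M c p e) (coord_vec M c p e')))"

definition nondegenerate_on :: "('v \<Rightarrow> 'v \<Rightarrow> real) \<Rightarrow> 'v::zero set \<Rightarrow> bool"
  where "nondegenerate_on b E \<longleftrightarrow> (\<forall>v\<in>E. (\<forall>w\<in>E. b v w = 0) \<longrightarrow> v = 0)"

definition pseudo_Riemannian_metric ::
    "('a, 'e::euclidean_space) manifold \<Rightarrow> ('a \<Rightarrow> ('a, 'e) tvec \<Rightarrow> ('a, 'e) tvec \<Rightarrow> real) \<Rightarrow> bool"
  where "pseudo_Riemannian_metric M g \<longleftrightarrow> smooth_symmetric_form_field M g \<and>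
    (\<forall>p\<in>points M. nondegenerate_on (g p) (tangent_space M p))"

definition almost_complex_structure ::
    "('a, 'e::euclidean_space) manifold \<Rightarrow> ('a \<Rightarrow> ('a, 'e) tvec \<Rightarrow> ('a, 'e) tvec) \<Rightarrow> bool"
  where "almost_complex_structure M J \<longleftrightarrow> smooth_endomorphism_field M J \<and>
    (\<forall>p\<in>points M. \<forall>v\<in>tangent_space M p. J p (J p v) = - v)"

definition norden_manifold ::
    "('a, 'e::euclidean_space) manifold \<Rightarrow> ('a \<Rightarrow> ('a, 'e) tvec \<Rightarrow> ('a, 'e) tvec) \<Rightarrow>
     ('a \<Rightarrow> ('a, 'e) tvec \<Rightarrow> ('a, 'e) tvec \<Rightarrow> real) \<Rightarrow> bool"
  where "norden_manifold M J g \<longleftrightarrow> smooth_manifold M \<and>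
    almost_complex_structure M J \<and> pseudo_Riemannian_metric M g \<and>
    (\<forall>p\<in>points M. \<forall>u\<in>tangent_space M p. \<forall>v\<in>tangent_space M p.
       g p (J p u) (J p v) = - g p u v)"

definition associated_metric ::
    "('a \<Rightarrow> 'v \<Rightarrow> 'v) \<Rightarrow> ('a \<Rightarrow> 'v \<Rightarrow> 'v \<Rightarrow> real) \<Rightarrow> 'a \<Rightarrow> 'v \<Rightarrow> 'v \<Rightarrow> real"
  where "associated_metric J g p u v = g p (J p u) v"


section \<open>Submanifolds and subbundles\<close>

text \<open>A submanifold is a subset of the ambient manifold carrying its own topology and smooth structure,
  such that the inclusion is a smooth immersion (so the topology may be finer than the subspace
  topology).\<close>

definition submanifold ::
    "('a, 'e::euclidean_space) manifold \<Rightarrow> ('a, 'f::euclidean_space) manifold \<Rightarrow> bool"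
  where "submanifold Mb M \<longleftrightarrow> smooth_manifold M \<and>
    points M \<subseteq> points Mb \<and> continuous_map (mtop M) (mtop Mb) id \<and>
    (\<forall>c\<in>atlas M. \<forall>c'\<in>atlas Mb. smooth_on (snd c ` (fst c \<inter> fst c')) (transition c c') \<and>
       (\<forall>p\<in>fst c \<inter> fst c'. inj (frechet_derivative (transition c c') (at (snd c p)))))"

text \<open>The tangent space of the submanifold \<open>M\<close> at \<open>p\<close> as a subspace of the tangent space of \<open>Mb\<close>, i.e.
  the image of the differential of the inclusion.\<close>

definition tangent_sub ::
    "('a, 'e::euclidean_space) manifold \<Rightarrow> ('a, 'f::euclidean_space) manifold \<Rightarrow> 'a \<Rightarrow>
     ('a, 'e) tvec set"
  where "tangent_sub Mb M p = {v \<in> tangent_space Mb p. \<exists>u\<in>tangent_space M p.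
    \<forall>c\<in>charts_at M p. \<forall>c'\<in>charts_at Mb p.
      v c' = frechet_derivative (transition c c') (at (snd c p)) (u c)}"

definition smooth_section_on ::
    "('a, 'e::euclidean_space) manifold \<Rightarrow> ('a, 'f::euclidean_space) manifold \<Rightarrow> 'a set \<Rightarrow>
     ('a \<Rightarrow> ('a, 'e) tvec) \<Rightarrow> bool"
  where "smooth_section_on Mb M U s \<longleftrightarrow> (\<forall>x\<in>U. s x \<in> tangent_space Mb x) \<and>
    (\<forall>c\<in>atlas M. \<forall>c'\<in>atlas Mb. smooth_on (snd c ` (U \<inter> fst c \<inter> fst c'))
       (\<lambda>y. s (inv_into (fst c) (snd c) y) c'))"

text \<open>A smooth rank \<open>k\<close> subbundle of the restriction to \<open>M\<close> of the tangent bundle of \<open>Mb\<close>: it has a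
  smooth local frame around every point of \<open>M\<close>.\<close>

definition subbundle ::
    "('a, 'e::euclidean_space) manifold \<Rightarrow> ('a, 'f::euclidean_space) manifold \<Rightarrow> nat \<Rightarrow>
     ('a \<Rightarrow> ('a, 'e) tvec set) \<Rightarrow> bool"
  where "subbundle Mb M k E \<longleftrightarrow> (\<forall>x\<in>points M. \<exists>U s. openin (mtop M) U \<and> x \<in> U \<and>
    (\<forall>i<k. smooth_section_on Mb M U (s i)) \<and>
    (\<forall>y\<in>U. inj_on (\<lambda>i. s i y) {..<k} \<and> independent ((\<lambda>i. s i y) ` {..<k}) \<and>
       span ((\<lambda>i. s i y) ` {..<k}) = E y))"

text \<open>A distribution on \<open>M\<close>, with the tangent bundle of \<open>M\<close> regarded as a subbundle of the restricted
  tangent bundle of \<open>Mb\<close>. As the inclusion is an immersion, a vector field tangent to \<open>M\<close> is smooth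
  as a section of either bundle or of none.\<close>

definition distribution ::
    "('a, 'e::euclidean_space) manifold \<Rightarrow> ('a, 'f::euclidean_space) manifold \<Rightarrow> nat \<Rightarrow>
     ('a \<Rightarrow> ('a, 'e) tvec set) \<Rightarrow> bool"
  where "distribution Mb M k E \<longleftrightarrow> subbundle Mb M k E \<and>
    (\<forall>x\<in>points M. E x \<subseteq> tangent_sub Mb M x)"

definition complementary_in :: "'v::real_vector set \<Rightarrow> 'v set \<Rightarrow> 'v set \<Rightarrow> bool"
  where "complementary_in V E F \<longleftrightarrow> E \<inter> F = {0} \<and> {u + v | u v. u \<in> E \<and> v \<in> F} = V"

definition orthogonal_space ::
    "('a, 'e::euclidean_space) manifold \<Rightarrow> ('a \<Rightarrow> ('a, 'e) tvec \<Rightarrow> ('a, 'e) tvec \<Rightarrow> real) \<Rightarrow>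
     'a \<Rightarrow> ('a, 'e) tvec set \<Rightarrow> ('a, 'e) tvec set"
  where "orthogonal_space Mb h p E = {v \<in> tangent_space Mb p. \<forall>w\<in>E. h p v w = 0}"

abbreviation normal_space ::
    "('a, 'e::euclidean_space) manifold \<Rightarrow> ('a \<Rightarrow> ('a, 'e) tvec \<Rightarrow> ('a, 'e) tvec \<Rightarrow> real) \<Rightarrow>
     ('a, 'f::euclidean_space) manifold \<Rightarrow> 'a \<Rightarrow> ('a, 'e) tvec set"
  where "normal_space Mb h M p \<equiv> orthogonal_space Mb h p (tangent_sub Mb M p)"

text \<open>No truncation occurs here: the differential of the inclusion is injective.\<close>

definition codimension ::
    "('a, 'e::euclidean_space) manifold \<Rightarrow> ('a, 'f::euclidean_space) manifold \<Rightarrow> nat"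
  where "codimension Mb M = DIM('e) - DIM('f)"


section \<open>CR-submanifolds\<close>

text \<open>Both distributions have positive rank. This excludes the holomorphic case (in particular open
  submanifolds) and the totally real case; a generic submanifold of one of these kinds would have
  zero radical, respectively be totally lightlike, with respect to the associated metric, and so
  would never be coisotropic.\<close>

definition CR_distributions ::
    "('a, 'e::euclidean_space) manifold \<Rightarrow> ('a \<Rightarrow> ('a, 'e) tvec \<Rightarrow> ('a, 'e) tvec) \<Rightarrow>
     ('a \<Rightarrow> ('a, 'e) tvec \<Rightarrow> ('a, 'e) tvec \<Rightarrow> real) \<Rightarrow> ('a, 'f::euclidean_space) manifold \<Rightarrow>
     ('a \<Rightarrow> ('a, 'e) tvec set) \<Rightarrow> ('a \<Rightarrow> ('a, 'e) tvec set) \<Rightarrow> bool"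
  where "CR_distributions Mb J g M D D' \<longleftrightarrow>
    (\<exists>k>0. distribution Mb M k D) \<and> (\<exists>k>0. distribution Mb M k D') \<and>
    (\<forall>x\<in>points M.
       nondegenerate_on (g x) (tangent_sub Mb M x) \<and>
       complementary_in (tangent_sub Mb M x) (D x) (D' x) \<and>
       (\<forall>u\<in>D x. \<forall>v\<in>D' x. g x u v = 0) \<and>
       J x ` D x = D x \<and>
       J x ` D' x \<subseteq> normal_space Mb g M x)"

definition CR_submanifold ::
    "('a, 'e::euclidean_space) manifold \<Rightarrow> ('a \<Rightarrow> ('a, 'e) tvec \<Rightarrow> ('a, 'e) tvec) \<Rightarrow>
     ('a \<Rightarrow> ('a, 'e) tvec \<Rightarrow> ('a, 'e) tvec \<Rightarrow> real) \<Rightarrow> ('a, 'f::euclidean_space) manifold \<Rightarrow> bool"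
  where "CR_submanifold Mb J g M \<longleftrightarrow> (\<exists>D D'. CR_distributions Mb J g M D D')"

definition generic_submanifold ::
    "('a, 'e::euclidean_space) manifold \<Rightarrow> ('a \<Rightarrow> ('a, 'e) tvec \<Rightarrow> ('a, 'e) tvec) \<Rightarrow>
     ('a \<Rightarrow> ('a, 'e) tvec \<Rightarrow> ('a, 'e) tvec \<Rightarrow> real) \<Rightarrow> ('a, 'f::euclidean_space) manifold \<Rightarrow> bool"
  where "generic_submanifold Mb J g M \<longleftrightarrow>
    (\<exists>D D'. CR_distributions Mb J g M D D' \<and> (\<forall>x\<in>points M. dim (D' x) = codimension Mb M))"


section \<open>Lightlike submanifolds\<close>

definition radical ::
    "('a, 'e::euclidean_space) manifold \<Rightarrow> ('a \<Rightarrow> ('a, 'e) tvec \<Rightarrow> ('a, 'e) tvec \<Rightarrow> real) \<Rightarrow>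
     ('a, 'f::euclidean_space) manifold \<Rightarrow> 'a \<Rightarrow> ('a, 'e) tvec set"
  where "radical Mb h M x = tangent_sub Mb M x \<inter> normal_space Mb h M x"

definition lightlike_submanifold ::
    "('a, 'e::euclidean_space) manifold \<Rightarrow> ('a \<Rightarrow> ('a, 'e) tvec \<Rightarrow> ('a, 'e) tvec \<Rightarrow> real) \<Rightarrow> nat \<Rightarrow>
     ('a, 'f::euclidean_space) manifold \<Rightarrow> bool"
  where "lightlike_submanifold Mb h r M \<longleftrightarrow> r > 0 \<and> distribution Mb M r (radical Mb h M)"

definition coisotropic ::
    "('a, 'e::euclidean_space) manifold \<Rightarrow> ('a \<Rightarrow> ('a, 'e) tvec \<Rightarrow> ('a, 'e) tvec \<Rightarrow> real) \<Rightarrow>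
     ('a, 'f::euclidean_space) manifold \<Rightarrow> bool"
  where "coisotropic Mb h M \<longleftrightarrow> lightlike_submanifold Mb h (codimension Mb M) M \<and>
    codimension Mb M < DIM('f)"

definition screen_distribution ::
    "('a, 'e::euclidean_space) manifold \<Rightarrow> ('a \<Rightarrow> ('a, 'e) tvec \<Rightarrow> ('a, 'e) tvec \<Rightarrow> real) \<Rightarrow>
     ('a, 'f::euclidean_space) manifold \<Rightarrow> ('a \<Rightarrow> ('a, 'e) tvec set) \<Rightarrow> bool"
  where "screen_distribution Mb h M S \<longleftrightarrow> (\<exists>k. distribution Mb M k S) \<and>
    (\<forall>x\<in>points M. complementary_in (tangent_sub Mb M x) (radical Mb h M x) (S x))"

text \<open>The lightlike transversal bundle belonging to a screen distribution \<open>S\<close>, for coisotropic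
  submanifolds. (In general one also chooses a screen transversal bundle and takes the complement
  inside the orthogonal complement of both; here the screen transversal bundle is zero.)\<close>

definition lightlike_transversal_bundle ::
    "('a, 'e::euclidean_space) manifold \<Rightarrow> ('a \<Rightarrow> ('a, 'e) tvec \<Rightarrow> ('a, 'e) tvec \<Rightarrow> real) \<Rightarrow>
     ('a, 'f::euclidean_space) manifold \<Rightarrow> ('a \<Rightarrow> ('a, 'e) tvec set) \<Rightarrow>
     ('a \<Rightarrow> ('a, 'e) tvec set) \<Rightarrow> bool"
  where "lightlike_transversal_bundle Mb h M S N \<longleftrightarrow> (\<exists>k. subbundle Mb M k N) \<and>
    (\<forall>x\<in>points M.
       complementary_in (orthogonal_space Mb h x (S x)) (radical Mb h M x) (N x) \<and>
       (\<forall>u\<in>N x. \<forall>v\<in>N x. h x u v = 0))"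

definition coisotropic_radical_transversal ::
    "('a, 'e::euclidean_space) manifold \<Rightarrow> ('a \<Rightarrow> ('a, 'e) tvec \<Rightarrow> ('a, 'e) tvec) \<Rightarrow>
     ('a \<Rightarrow> ('a, 'e) tvec \<Rightarrow> ('a, 'e) tvec \<Rightarrow> real) \<Rightarrow> ('a, 'f::euclidean_space) manifold \<Rightarrow> bool"
  where "coisotropic_radical_transversal Mb J h M \<longleftrightarrow> coisotropic Mb h M \<and>
    (\<exists>S N. screen_distribution Mb h M S \<and> lightlike_transversal_bundle Mb h M S N \<and>
       (\<forall>x\<in>points M. J x ` radical Mb h M x = N x \<and> J x ` S x = S x))"

end

theory Submission
  imports Defs
begin

text \<open>
  At a point \<open>x\<close> of the submanifold write \<open>T\<close> for its tangent space. The Norden condition makes \<open>J\<close>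
  self-adjoint for \<open>g\<close>, and the associated metric is \<open>g (J u) v\<close>; so the radical of \<open>T\<close> consists of
  those \<open>v \<in> T\<close> for which \<open>J v\<close> is \<open>g\<close>-normal to \<open>T\<close>, and on a \<open>J\<close>-invariant space orthogonality means
  the same for both metrics. This suggests the dictionary between the two structures: the holomorphic
  distribution \<open>D\<close> is the screen distribution, the totally real distribution \<open>D'\<close> is the radical, and
  \<open>J D'\<close> is the lightlike transversal bundle.

  From CR to lightlike: \<open>D'\<close> lies in the radical because \<open>J D'\<close> is normal, and no non-zero vector of \<open>D\<close> does,
  because \<open>J\<close> maps \<open>D\<close> onto itself and \<open>g\<close> is non-degenerate on \<open>T\<close>. Hence the radical is exactly \<open>D'\<close>
  (\<open>CR_radical\<close>). That \<open>J D'\<close> complements \<open>D'\<close> in the orthogonal space of \<open>D\<close> is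
  \<open>CR_transversal_complement\<close>.

  From lightlike to CR: the orthogonality relations are immediate, and the point is that \<open>g\<close> is
  non-degenerate on \<open>T\<close> (\<open>radical_transversal_nondegenerate\<close>). A vector of \<open>T\<close> that is \<open>g\<close>-orthogonal
  to \<open>T\<close> turns out to lie in the radical, where it is also \<open>g\<close>-orthogonal to the image of the radical
  under \<open>J\<close>.

  Both directions rest on the same dimension count. The image of the radical under \<open>J\<close> meets \<open>T\<close>
  only in \<open>0\<close> and its dimension is the codimension of the submanifold, so together with \<open>T\<close> it spans
  the ambient tangent space (\<open>complementary_to_tangent_sub\<close>). It is here that genericity, respectively
  coisotropy, enters.

  The only analytic content is that applying \<open>J\<close> to a smooth frame gives a smooth frame, so that
  \<open>J D'\<close> is a subbundle (\<open>subbundle_image_endomorphism\<close>). In coordinates this is smoothness of products and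
  compositions, since the components of \<open>J\<close> are smooth functions on the ambient manifold and have to be
  pulled back along the inclusion.
\<close>

section \<open>Linear algebra of one tangent space\<close>

text \<open>Tangent vectors are functions on the set of charts, so they live in an infinite-dimensional space.
  Dimensions of their subspaces are computed by transport from a Euclidean space.\<close>

lemma dim_linear_image:
  fixes f :: "'v::real_vector \<Rightarrow> 'w::real_vector"
  assumes "linear f" "inj f"
  shows "dim (f ` S) = dim S"
proof -
  obtain B where B: "B \<subseteq> S" "independent B" "S \<subseteq> span B" "card B = dim S"
    by (rule real_vector.basis_exists)
  have "dim (f ` S) = card (f ` B)"
  proof (rule real_vector.dim_unique)
    show "f ` S \<subseteq> span (f ` B)"
      using B(3) linear_span_image[OF assms(1), of B] by blast
    show "independent (f ` B)"
      using linear_independent_injective_image[OF assms(1) B(2)] assms(2) by (auto intro: inj_on_subset)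
  qed (use B in auto)
  then show ?thesis
    using B(4) assms(2) by (simp add: card_image inj_on_subset)
qed

text \<open>The finite-dimensional ambient space enters as the range of an injective linear map; a chart
  provides such a map for the tangent spaces of a manifold and of a submanifold.\<close>

lemma complementary_in_range_iff_dim:
  fixes \<psi> :: "'e::euclidean_space \<Rightarrow> 'v::real_vector"
  assumes \<psi>: "linear \<psi>" "inj \<psi>"
    and E: "subspace E" "E \<subseteq> range \<psi>"
    and F: "subspace F" "F \<subseteq> range \<psi>"
    and EF: "E \<inter> F = {0}"
  shows "complementary_in (range \<psi>) E F \<longleftrightarrow> dim E + dim F = DIM('e)"
proof -
  define E' F' W where "E' = \<psi> -` E" and "F' = \<psi> -` F" and "W = {x + y |x y. x \<in> E' \<and> y \<in> F'}"
  have sub: "subspace E'" "subspace F'"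
    unfolding E'_def F'_def by (auto intro: linear_subspace_vimage \<psi> E F)
  have im: "\<psi> ` E' = E" "\<psi> ` F' = F"
    using E(2) F(2) by (auto simp: E'_def F'_def)
  have "E' \<inter> F' = {0}"
    using EF \<psi> by (force simp: E'_def F'_def linear_0 linear_injective_0)
  moreover have "dim E' = dim E" "dim F' = dim F"
    using dim_linear_image[OF \<psi>] im by metis+
  ultimately have dimW: "dim W = dim E + dim F"
    using dim_sums_Int[OF sub] by (simp add: W_def)
  have "{u + v |u v. u \<in> E \<and> v \<in> F} = \<psi> ` W"
    unfolding W_def im[symmetric] by (force simp: linear_add[OF \<psi>(1)])
  then have "complementary_in (range \<psi>) E F \<longleftrightarrow> \<psi> ` W = range \<psi>"
    using EF by (simp add: complementary_in_def)
  also have "\<dots> \<longleftrightarrow> W = UNIV"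
    using \<psi>(2) by (simp add: inj_image_eq_iff)
  also have "\<dots> \<longleftrightarrow> dim W = DIM('e)"
    using dim_eq_full[of W] subspace_sums[OF sub]
    by (metis W_def span_eq_iff)
  finally show ?thesis using dimW by simp
qed

lemma complementary_in_subset:
  assumes "complementary_in T E F" "subspace E" "subspace F"
  shows "E \<subseteq> T" "F \<subseteq> T"
proof -
  have "u + v \<in> T" if "u \<in> E" "v \<in> F" for u v
    using assms(1) that unfolding complementary_in_def by blast
  from this[OF _ subspace_0[OF assms(3)]] this[OF subspace_0[OF assms(2)]]
  show "E \<subseteq> T" "F \<subseteq> T" by auto
qed

lemma complementary_inE:
  assumes "complementary_in T E F" "w \<in> T"
  obtains u v where "w = u + v" "u \<in> E" "v \<in> F"
  using assms unfolding complementary_in_def by blast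

lemma complementary_in_commute: "complementary_in T E F \<longleftrightarrow> complementary_in T F E"
proof -
  have "{u + v |u v. u \<in> E \<and> v \<in> F} = {u + v |u v. u \<in> F \<and> v \<in> E}"
    by (auto, (metis add.commute)+)
  then show ?thesis by (simp add: complementary_in_def Int_commute)
qed

text \<open>One tangent space of an almost complex manifold with Norden metric. All laws are relative to
  \<open>V\<close>, since tensor fields are constrained on tangent vectors only.\<close>

locale norden_space =
  fixes V :: "'v::real_vector set" and J :: "'v \<Rightarrow> 'v" and g :: "'v \<Rightarrow> 'v \<Rightarrow> real"
  assumes subspace_V: "subspace V"
    and J_closed: "u \<in> V \<Longrightarrow> J u \<in> V"
    and J_add: "u \<in> V \<Longrightarrow> v \<in> V \<Longrightarrow> J (u + v) = J u + J v"
    and J_J: "u \<in> V \<Longrightarrow> J (J u) = - u"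
    and g_sym: "u \<in> V \<Longrightarrow> v \<in> V \<Longrightarrow> g u v = g v u"
    and g_add: "u \<in> V \<Longrightarrow> v \<in> V \<Longrightarrow> w \<in> V \<Longrightarrow> g (u + v) w = g u w + g v w"
    and g_scale: "u \<in> V \<Longrightarrow> v \<in> V \<Longrightarrow> g (a *\<^sub>R u) v = a * g u v"
    and g_J_J: "u \<in> V \<Longrightarrow> v \<in> V \<Longrightarrow> g (J u) (J v) = - g u v"
    and g_nondegenerate: "nondegenerate_on g V"
begin

lemma J_0: "J 0 = 0"
  using J_add[of 0 0] subspace_0[OF subspace_V] by simp

lemma g_minus: "u \<in> V \<Longrightarrow> v \<in> V \<Longrightarrow> g (- u) v = - g u v"
  using g_scale[of u v "-1"] by simp

lemma g_add_right: "u \<in> V \<Longrightarrow> v \<in> V \<Longrightarrow> w \<in> V \<Longrightarrow> g u (v + w) = g u v + g u w"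
  using g_add g_sym subspace_add[OF subspace_V] by metis

text \<open>Self-adjointness of \<open>J\<close> is the Norden condition with one argument replaced by its image under
  \<open>J\<close>. It says that the associated metric is symmetric.\<close>

lemma g_J_swap:
  assumes "u \<in> V" "v \<in> V"
  shows "g (J u) v = g u (J v)"
proof -
  have "- g u (J v) = g (J u) (- v)"
    using g_J_J[of u "J v"] assms by (simp add: J_closed J_J)
  also have "\<dots> = - g (J u) v"
    using g_minus[of v "J u"] g_sym[of "J u" v] g_sym[of "J u" "- v"] assms subspace_neg[OF subspace_V]
    by (simp add: J_closed)
  finally show ?thesis by simp
qed

definition perp :: "'v set \<Rightarrow> 'v set"
  where "perp E = {v \<in> V. \<forall>w\<in>E. g v w = 0}"

text \<open>The orthogonal space with respect to the associated metric.\<close>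

definition perp_tilde :: "'v set \<Rightarrow> 'v set"
  where "perp_tilde E = {v \<in> V. \<forall>w\<in>E. g (J v) w = 0}"

lemma subspace_perp: "E \<subseteq> V \<Longrightarrow> subspace (perp E)"
  using g_scale[OF subspace_0[OF subspace_V], of _ 0] subspace_V
  by (auto simp: perp_def subspace_def g_add g_scale subset_iff)

lemma perp_tilde_eq_vimage: "perp_tilde E = {v \<in> V. J v \<in> perp E}"
  by (auto simp: perp_tilde_def perp_def J_closed)

lemma perp_tilde_eq_perp_J: "E \<subseteq> V \<Longrightarrow> perp_tilde E = perp (J ` E)"
  by (auto simp: perp_tilde_def perp_def g_J_swap subset_iff)

lemma subspace_perp_tilde:
  assumes "E \<subseteq> V"
  shows "subspace (perp_tilde E)"
  unfolding perp_tilde_eq_perp_J[OF assms]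
  by (rule subspace_perp) (use assms J_closed in auto)

text \<open>The \<open>D\<close>-component \<open>d\<close> of a radical vector is again radical, as \<open>D'\<close> is contained in the radical.
  Then \<open>J d\<close> is normal to \<open>T\<close>, yet it lies in \<open>D\<close> and hence in \<open>T\<close>, so it vanishes by non-degeneracy.\<close>

lemma CR_radical:
  assumes T: "subspace T" "T \<subseteq> V" "nondegenerate_on g T"
    and c: "complementary_in T D D'"
    and JD: "J ` D = D" and JD': "J ` D' \<subseteq> perp T"
    and sub: "subspace D" "subspace D'"
  shows "T \<inter> perp_tilde T = D'"
proof
  have TD: "D \<subseteq> T" "D' \<subseteq> T"
    using complementary_in_subset[OF c sub] by auto
  then show "D' \<subseteq> T \<inter> perp_tilde T"
    using JD' T(2) by (auto simp: perp_tilde_eq_vimage)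
  show "T \<inter> perp_tilde T \<subseteq> D'"
  proof
    fix v assume v: "v \<in> T \<inter> perp_tilde T"
    then obtain d d' where d: "v = d + d'" "d \<in> D" "d' \<in> D'"
      using c unfolding complementary_in_def by blast
    have "d \<in> perp_tilde T"
      using subspace_diff[OF subspace_perp_tilde[OF T(2)], of v d'] v d \<open>D' \<subseteq> T \<inter> perp_tilde T\<close>
      by auto
    then have "J d = 0"
      using T(3) JD d(2) TD(1) unfolding nondegenerate_on_def perp_tilde_def by blast
    then have "d = 0"
      using J_J[of d] J_0 d(2) TD(1) T(2) by auto
    then show "v \<in> D'" using d by simp
  qed
qed

text \<open>As \<open>D\<close> is \<open>J\<close>-invariant, its orthogonal space is the same for both metrics, and it contains both
  \<open>D'\<close> and \<open>J D'\<close>. Conversely, split a vector orthogonal to \<open>D\<close> along \<open>V = D + D' + J D'\<close>: its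
  \<open>D\<close>-component is orthogonal to \<open>D\<close> and to \<open>D'\<close>, hence zero.\<close>

lemma CR_transversal_complement:
  assumes T: "subspace T" "T \<subseteq> V" "nondegenerate_on g T"
    and c: "complementary_in T D D'"
    and orth: "\<And>u v. u \<in> D \<Longrightarrow> v \<in> D' \<Longrightarrow> g u v = 0"
    and JD: "J ` D = D" and JD': "J ` D' \<subseteq> perp T"
    and sub: "subspace D" "subspace D'"
    and V: "{u + v | u v. u \<in> T \<and> v \<in> J ` D'} = V"
  shows "complementary_in (perp_tilde D) D' (J ` D')"
  unfolding complementary_in_def
proof
  have TD: "D \<subseteq> T" "D' \<subseteq> T"
    using complementary_in_subset[OF c sub] by auto
  have DV: "D \<subseteq> V" using TD T by blast
  have pD: "perp_tilde D = perp D"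
    using perp_tilde_eq_perp_J[OF DV] JD by simp
  have Tp: "T \<inter> perp T = {0}"
    using T subspace_0[OF subspace_perp[OF T(2)]] subspace_0[OF T(1)]
    by (auto simp: nondegenerate_on_def perp_def)
  have "0 \<in> J ` D'" using J_0 subspace_0[OF sub(2)] by force
  then show "D' \<inter> J ` D' = {0}" using TD JD' Tp subspace_0[OF sub(2)] by blast
  have D'D: "D' \<subseteq> perp D"
  proof
    fix v assume v: "v \<in> D'"
    have "g v w = 0" if "w \<in> D" for w
      using orth[OF that v] g_sym[of v w] v that TD T(2) by auto
    then show "v \<in> perp D" using v TD T(2) by (auto simp: perp_def)
  qed
  have pT: "J ` D' \<subseteq> perp D" using JD' TD by (auto simp: perp_def)
  have "v \<in> {u + w |u w. u \<in> D' \<and> w \<in> J ` D'}" if v: "v \<in> perp D" for v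
  proof -
    obtain t w where t: "v = t + w" "t \<in> T" "w \<in> J ` D'"
      using V v unfolding perp_def by blast
    obtain d d' where d: "t = d + d'" "d \<in> D" "d' \<in> D'"
      using complementary_inE[OF c t(2)] .
    have "v - w - d' \<in> perp D"
      by (intro subspace_diff[OF subspace_perp[OF DV]] v subsetD[OF pT t(3)] subsetD[OF D'D d(3)])
    then have dD: "d \<in> perp D" using t d by simp
    have "g d u = 0" if u: "u \<in> T" for u
    proof -
      obtain a b where "u = a + b" "a \<in> D" "b \<in> D'"
        using complementary_inE[OF c u] .
      then show ?thesis
        using dD d(2) orth g_add_right[of d a b] TD T(2) by (auto simp: perp_def subset_iff)
    qed
    then have "d = 0" using T(3) d(2) TD by (auto simp: nondegenerate_on_def)
    then show ?thesis using t d by auto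
  qed
  then show "{u + v |u v. u \<in> D' \<and> v \<in> J ` D'} = perp_tilde D"
    using subspace_add[OF subspace_perp[OF DV]] subsetD[OF D'D] subsetD[OF pT] unfolding pD
    by (intro equalityI subsetI) (simp, auto)
qed

text \<open>For a vector of \<open>T\<close> in the transversal space, the screen component is orthogonal to the screen and
  to the radical, so it is radical and vanishes. The vector is then itself in the radical, which
  meets its complement \<open>N\<close> trivially.\<close>

lemma radical_transversal_Int:
  assumes T: "subspace T" "T \<subseteq> V"
    and R: "R = T \<inter> perp_tilde T"
    and S: "subspace S" "complementary_in T R S"
    and N: "complementary_in (perp_tilde S) R N" "0 \<in> N"
  shows "T \<inter> N = {0}"
proof -
  have R0: "subspace R" unfolding R by (intro subspace_inter T subspace_perp_tilde)
  have RS: "R \<subseteq> T" "S \<subseteq> T"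
    using complementary_in_subset[OF S(2) R0 S(1)] by auto
  have "v = 0" if v: "v \<in> T" "v \<in> N" for v
  proof -
    obtain r s where r: "v = r + s" "r \<in> R" "s \<in> S"
      using complementary_inE[OF S(2) v(1)] .
    have "v \<in> perp_tilde S" using v N subspace_0[OF R0] unfolding complementary_in_def by force
    moreover have "r \<in> perp_tilde S" using r RS R by (auto simp: perp_tilde_def)
    ultimately have sS: "s \<in> perp_tilde S"
      using subspace_diff[OF subspace_perp_tilde[of S], of v r] r RS T(2) by auto
    have "g (J s) u = 0" if u: "u \<in> T" for u
    proof -
      obtain a b where ab: "u = a + b" "a \<in> R" "b \<in> S"
        using complementary_inE[OF S(2) u] .
      have in_V: "s \<in> V" "a \<in> V" "b \<in> V" using r ab RS T(2) by auto
      have "g (J s) a = g (J a) s" using g_J_swap[of s a] g_sym[of s "J a"] in_V J_closed by simp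
      also have "\<dots> = 0" using ab(2) r(3) RS unfolding R perp_tilde_def by auto
      finally show ?thesis
        using ab sS g_add_right[of "J s" a b] in_V J_closed by (auto simp: perp_tilde_def)
    qed
    then have "s \<in> R" using r(3) RS T(2) unfolding R perp_tilde_def by auto
    then have "s = 0" using r(3) S(2) unfolding complementary_in_def by blast
    then show ?thesis using r v N(1) unfolding complementary_in_def by auto
  qed
  then show ?thesis using N(2) subspace_0[OF T(1)] by blast
qed

text \<open>A vector of the \<open>J\<close>-invariant screen is \<open>J s\<close> with \<open>s\<close> in the screen, so its \<open>g\<close>-product with a
  radical vector is the associated product of \<open>s\<close> with that vector.\<close>

lemma radical_transversal_orthogonal:
  assumes T: "T \<subseteq> V"
    and R: "R = T \<inter> perp_tilde T"
    and S: "S \<subseteq> T" "J ` S = S"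
    and u: "u \<in> S" "v \<in> R"
  shows "g u v = 0"
proof -
  obtain s where s: "s \<in> S" "u = J s" using S(2) u(1) by blast
  have "g (J s) v = g (J v) s"
    using g_J_swap[of s v] g_sym[of s "J v"] s S R u T J_closed by auto
  also have "\<dots> = 0" using s S R u unfolding perp_tilde_def by auto
  finally show ?thesis using s by simp
qed

text \<open>Let \<open>v \<in> T\<close> be \<open>g\<close>-orthogonal to \<open>T\<close>, with screen component \<open>s\<close>. Screen and radical are
  \<open>g\<close>-orthogonal, so \<open>s\<close> is normal to \<open>T\<close>; by invariance of the screen so is \<open>J s\<close>, that is, \<open>s\<close> is
  radical and therefore zero. Thus \<open>v\<close> is radical and \<open>g\<close>-orthogonal to \<open>T\<close> as well as to \<open>J R\<close>, which
  together span \<open>V\<close>.\<close>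

lemma radical_transversal_nondegenerate:
  assumes T: "subspace T" "T \<subseteq> V"
    and R: "R = T \<inter> perp_tilde T"
    and S: "subspace S" "complementary_in T R S" "J ` S = S"
    and V: "{u + v | u v. u \<in> T \<and> v \<in> J ` R} = V"
  shows "nondegenerate_on g T"
  unfolding nondegenerate_on_def
proof (intro ballI impI)
  fix v assume v: "v \<in> T" and g0: "\<forall>w\<in>T. g v w = 0"
  have R0: "subspace R" unfolding R by (intro subspace_inter T subspace_perp_tilde)
  have RS: "R \<subseteq> T" "S \<subseteq> T"
    using complementary_in_subset[OF S(2) R0 S(1)] by auto
  note orth = radical_transversal_orthogonal[OF T(2) R RS(2) S(3)]
  obtain r s where r: "v = r + s" "r \<in> R" "s \<in> S"
    using complementary_inE[OF S(2) v] .
  have rsV: "r \<in> V" "s \<in> V" using r RS T by auto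
  have s0: "g s w = 0" if w: "w \<in> T" for w
  proof -
    obtain a b where ab: "w = a + b" "a \<in> R" "b \<in> S"
      using complementary_inE[OF S(2) w] .
    have abV: "a \<in> V" "b \<in> V" using ab RS T by auto
    have "g r b = 0" using orth[of b r] g_sym[of b r] ab r rsV abV by simp
    moreover have "g v b = 0" using g0 ab RS by auto
    ultimately have "g s b = 0" using g_add[of r s b] r rsV abV by simp
    then show ?thesis using ab orth[OF r(3) ab(2)] g_add_right[of s a b] rsV abV by simp
  qed
  have "g (J s) w = 0" if w: "w \<in> T" for w
  proof -
    obtain a b where ab: "w = a + b" "a \<in> R" "b \<in> S"
      using complementary_inE[OF S(2) w] .
    have abV: "a \<in> V" "b \<in> V" using ab RS T by auto
    have "J b \<in> S" "J s \<in> S" using ab r S(3) by auto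
    then have "g (J s) b = 0" "g (J s) a = 0"
      using s0[OF subsetD[OF RS(2)]] g_J_swap[OF rsV(2) abV(2)] orth[OF _ ab(2)] by metis+
    then show ?thesis using ab(1) g_add_right[OF J_closed[OF rsV(2)] abV] by simp
  qed
  then have "s \<in> R" using r(3) RS rsV unfolding R perp_tilde_def by auto
  then have "s = 0" using r(3) S(2) unfolding complementary_in_def by blast
  then have vR: "v \<in> R" using r by simp
  have vV: "v \<in> V" using v T by auto
  have "g v w = 0" if w: "w \<in> V" for w
  proof -
    obtain t q where t: "w = t + J q" "t \<in> T" "q \<in> R" using V w by blast
    have qV: "q \<in> V" "t \<in> V" using t RS T by auto
    have "g v (J q) = g (J v) q" using g_J_swap[of v q] vV qV by simp
    also have "\<dots> = 0" using vR t(3) RS unfolding R perp_tilde_def by auto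
    finally show ?thesis using t g0 g_add_right[of v t "J q"] vV qV J_closed by simp
  qed
  then show "v = 0" using g_nondegenerate vV unfolding nondegenerate_on_def by blast
qed

end

section \<open>Calculus of \<open>C^k\<close> maps\<close>

text \<open>Openness of \<open>S\<close> matters: derivatives are taken in the full space, so they depend on the values
  near a point and not just on \<open>S\<close>.\<close>

lemma Ck_on_cong:
  assumes "open S" "Ck_on k S f" "\<And>x. x \<in> S \<Longrightarrow> f x = h x"
  shows "Ck_on k S h"
  using assms(2,3)
proof (induction k arbitrary: f h)
  case 0
  then show ?case by (metis Ck_on.simps(1) continuous_on_cong)
next
  case (Suc k)
  have d: "f differentiable (at x)" if "x \<in> S" for x
    using Suc.prems that by auto
  have "h differentiable (at x)" if "x \<in> S" for x
    using d[OF that] has_derivative_transform_within_open[where f = f and g = h, OF _ assms(1) that Suc.prems(2)]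
    unfolding differentiable_def by blast
  moreover have "Ck_on k S (\<lambda>x. frechet_derivative h (at x) v)" for v
  proof (rule Suc.IH)
    show "Ck_on k S (\<lambda>x. frechet_derivative f (at x) v)" using Suc.prems by auto
    show "frechet_derivative f (at x) v = frechet_derivative h (at x) v" if "x \<in> S" for x
      using frechet_derivative_transform_within_open[OF d[OF that] assms(1) that Suc.prems(2)] by simp
  qed
  ultimately show ?case by simp
qed

lemma Ck_on_SucD: "Ck_on (Suc k) S f \<Longrightarrow> Ck_on k S f"
proof (induction k arbitrary: f)
  case 0
  then show ?case
    by (auto intro!: continuous_at_imp_continuous_on differentiable_imp_continuous_within)
next
  case (Suc k)
  from Suc.prems Suc.IH show ?case unfolding Ck_on.simps(2)[of "Suc k"] Ck_on.simps(2)[of k] by blast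
qed

lemma Ck_on_subset: "Ck_on k S f \<Longrightarrow> R \<subseteq> S \<Longrightarrow> Ck_on k R f"
  by (induction k arbitrary: f) (auto intro: continuous_on_subset)

lemma Ck_on_SucI:
  assumes "open S"
    and "\<And>x. x \<in> S \<Longrightarrow> (f has_derivative (\<lambda>v. f' v x)) (at x)"
    and "\<And>v. Ck_on k S (f' v)"
  shows "Ck_on (Suc k) S f"
proof -
  have "Ck_on k S (\<lambda>x. frechet_derivative f (at x) v)" for v
    by (rule Ck_on_cong[OF assms(1) assms(3)[of v]]) (simp add: frechet_derivative_at[OF assms(2), symmetric])
  then show ?thesis using assms(2) by (auto simp: differentiable_def)
qed

lemma Ck_on_const: "Ck_on k S (\<lambda>x. c)"
  by (induction k arbitrary: c) (auto intro: continuous_on_const)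

lemma Ck_on_add:
  assumes "open S" "Ck_on k S f" "Ck_on k S h"
  shows "Ck_on k S (\<lambda>x. f x + h x)"
  using assms(2,3)
proof (induction k arbitrary: f h)
  case 0
  then show ?case by (auto intro: continuous_on_add)
next
  case (Suc k)
  show ?case
  proof (rule Ck_on_SucI[OF assms(1)])
    show "((\<lambda>x. f x + h x) has_derivative
        (\<lambda>v. (\<lambda>x. frechet_derivative f (at x) v + frechet_derivative h (at x) v) x)) (at x)"
      if "x \<in> S" for x
      using Suc.prems that by (auto intro!: has_derivative_add simp: frechet_derivative_works[symmetric])
    show "Ck_on k S (\<lambda>x. frechet_derivative f (at x) v + frechet_derivative h (at x) v)" for v
      using Suc by auto
  qed
qed

lemma Ck_on_sum:
  assumes "open S" "finite I" "\<And>i. i \<in> I \<Longrightarrow> Ck_on k S (f i)"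
  shows "Ck_on k S (\<lambda>x. \<Sum>i\<in>I. f i x)"
  using assms(2,3)
  by (induction I rule: finite_induct) (auto intro: Ck_on_const Ck_on_add assms(1))

lemma Ck_on_scaleR:
  assumes "open S" "Ck_on k S f" "Ck_on k S h"
  shows "Ck_on k S (\<lambda>x. f x *\<^sub>R h x)"
  using assms(2,3)
proof (induction k arbitrary: f h)
  case 0
  then show ?case by (auto intro: continuous_on_scaleR)
next
  case (Suc k)
  show ?case
  proof (rule Ck_on_SucI[OF assms(1)])
    show "((\<lambda>x. f x *\<^sub>R h x) has_derivative
        (\<lambda>v. (\<lambda>x. f x *\<^sub>R frechet_derivative h (at x) v + frechet_derivative f (at x) v *\<^sub>R h x) x)) (at x)"
      if "x \<in> S" for x
      using Suc.prems that by (auto intro!: has_derivative_scaleR simp: frechet_derivative_works[symmetric])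
    show "Ck_on k S (\<lambda>x. f x *\<^sub>R frechet_derivative h (at x) v + frechet_derivative f (at x) v *\<^sub>R h x)" for v
      using Suc.prems by (intro Ck_on_add[OF assms(1)] Suc.IH) (auto dest: Ck_on_SucD simp del: Ck_on.simps, auto)
  qed
qed

lemma Ck_on_bounded_linear:
  assumes "open S" "bounded_linear L" "Ck_on k S f"
  shows "Ck_on k S (\<lambda>x. L (f x))"
  using assms(3)
proof (induction k arbitrary: f)
  case 0
  then show ?case by (auto intro: bounded_linear.continuous_on assms(2))
next
  case (Suc k)
  show ?case
  proof (rule Ck_on_SucI[OF assms(1)])
    show "((\<lambda>x. L (f x)) has_derivative (\<lambda>v. (\<lambda>x. L (frechet_derivative f (at x) v)) x)) (at x)"
      if "x \<in> S" for x
      using Suc.prems that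
      by (auto intro!: bounded_linear.has_derivative[OF assms(2)] simp: frechet_derivative_works[symmetric])
    show "Ck_on k S (\<lambda>x. L (frechet_derivative f (at x) v))" for v
      using Suc by auto
  qed
qed

text \<open>The derivative of the composite is expanded in the standard basis. This turns the chain rule into
  a sum of products of \<open>C^k\<close> functions, to which the induction hypothesis and the product rule apply.\<close>

lemma Ck_on_compose:
  fixes f :: "'e::euclidean_space \<Rightarrow> 'f::euclidean_space"
  assumes "open S" "Ck_on k S f" "Ck_on k R h" "f ` S \<subseteq> R"
  shows "Ck_on k S (\<lambda>x. h (f x))"
  using assms(2,3)
proof (induction k arbitrary: h)
  case 0
  then show ?case using assms(4) by (auto intro: continuous_on_compose2)
next
  case (Suc k)
  define D where "D v x = (\<Sum>i\<in>Basis. (frechet_derivative f (at x) v \<bullet> i) *\<^sub>R frechet_derivative h (at (f x)) i)" for v x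
  show ?case
  proof (rule Ck_on_SucI[OF assms(1)])
    fix x assume x: "x \<in> S"
    have df: "(f has_derivative frechet_derivative f (at x)) (at x)"
      and dh: "(h has_derivative frechet_derivative h (at (f x))) (at (f x))"
      using Suc.prems x assms(4) by (auto simp: frechet_derivative_works[symmetric])
    have expand: "frechet_derivative h (at (f x)) w = (\<Sum>i\<in>Basis. (w \<bullet> i) *\<^sub>R frechet_derivative h (at (f x)) i)" for w
    proof -
      have "frechet_derivative h (at (f x)) w = frechet_derivative h (at (f x)) (\<Sum>i\<in>Basis. (w \<bullet> i) *\<^sub>R i)"
        by (simp only: euclidean_representation)
      then show ?thesis
        by (simp only: linear_sum[OF has_derivative_linear[OF dh]] linear_scale[OF has_derivative_linear[OF dh]])
    qed
    have "(\<lambda>v. D v x) = frechet_derivative h (at (f x)) \<circ> frechet_derivative f (at x)"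
      by (intro ext) (unfold D_def o_def, rule expand[symmetric])
    then show "((\<lambda>x. h (f x)) has_derivative (\<lambda>v. D v x)) (at x)"
      using diff_chain_at[OF df dh] by (simp add: o_def)
  next
    fix v
    have "Ck_on k S (\<lambda>x. frechet_derivative h (at (f x)) i)" for i
      using Suc.prems Suc.IH[of "\<lambda>y. frechet_derivative h (at y) i"] Ck_on_SucD[of k S f] by auto
    moreover have "Ck_on k S (\<lambda>x. frechet_derivative f (at x) v \<bullet> i)" for i
      using Suc.prems by (intro Ck_on_bounded_linear[OF assms(1) bounded_linear_inner_left]) auto
    ultimately show "Ck_on k S (D v)"
      unfolding D_def by (intro Ck_on_sum Ck_on_scaleR assms(1)) auto
  qed
qed

section \<open>Charts and tangent spaces\<close>

context
  fixes M :: "('a, 'e::euclidean_space) manifold"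
  assumes M: "smooth_manifold M"
begin

lemma chart_homeo:
  assumes "c \<in> atlas M"
  shows "openin (mtop M) (fst c)" "open (snd c ` fst c)"
    "homeomorphic_map (subtopology (mtop M) (fst c)) (top_of_set (snd c ` fst c)) (snd c)"
  using M assms unfolding smooth_manifold_def by (auto simp: split_beta)

lemma chart_inj: "c \<in> atlas M \<Longrightarrow> inj_on (snd c) (fst c)"
  using homeomorphic_imp_injective_map[OF chart_homeo(3)] openin_subset[OF chart_homeo(1)]
  by (metis topspace_subtopology_subset)

lemma open_chart_image:
  assumes c: "c \<in> atlas M" and U: "openin (mtop M) U"
  shows "open (snd c ` (U \<inter> fst c))"
proof -
  have "openin (subtopology (mtop M) (fst c)) (U \<inter> fst c)"
    using U by (auto simp: openin_subtopology)
  then have "openin (top_of_set (snd c ` fst c)) (snd c ` (U \<inter> fst c))"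
    using homeomorphic_imp_open_map[OF chart_homeo(3)[OF c]] by (auto simp: open_map_def)
  then show ?thesis
    using chart_homeo(2)[OF c] openin_open_trans by blast
qed

lemma obtain_chart:
  assumes "p \<in> points M"
  obtains c where "c \<in> charts_at M p"
  using M assms unfolding smooth_manifold_def charts_at_def by blast

lemma points_nonempty: "points M \<noteq> {}"
  using M unfolding smooth_manifold_def by blast

lemma smooth_transition: "c \<in> atlas M \<Longrightarrow> c' \<in> atlas M \<Longrightarrow> smooth_on (snd c ` (fst c \<inter> fst c')) (transition c c')"
  using M unfolding smooth_manifold_def by blast

end

lemma smooth_on_imp_differentiable: "smooth_on S f \<Longrightarrow> x \<in> S \<Longrightarrow> f differentiable (at x)"
  unfolding smooth_on_def by (metis Ck_on.simps(2))

lemma transition_apply: "inj_on (snd c) (fst c) \<Longrightarrow> p \<in> fst c \<Longrightarrow> transition c c' (snd c p) = snd c' p"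
  by (simp add: transition_def)

lemma frechet_derivative_transition_self:
  assumes "inj_on (snd c) (fst c)" "open (snd c ` fst c)" "p \<in> fst c"
  shows "frechet_derivative (transition c c) (at (snd c p)) = (\<lambda>v. v)"
proof -
  have "frechet_derivative (\<lambda>x. x) (at (snd c p)) = frechet_derivative (transition c c) (at (snd c p))"
    by (rule frechet_derivative_transform_within_open[OF _ assms(2)])
       (use assms in \<open>auto simp: transition_apply\<close>)
  then show ?thesis by simp
qed

text \<open>The chain rule for three charts. The charts may belong to different manifolds, so it covers
  changes of coordinates as well as the coordinate expressions of an inclusion. \<open>W\<close> is a set of points
  whose coordinates form a neighbourhood on which the composite of the transitions is the transition.\<close>

lemma frechet_derivative_transition_trans:
  fixes c :: "('a, 'e::euclidean_space) chart" and c' :: "('a, 'f::euclidean_space) chart"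
    and c'' :: "('a, 'h::euclidean_space) chart"
  assumes inj: "inj_on (snd c) (fst c)" "inj_on (snd c') (fst c')"
    and W: "open (snd c ` W)" "p \<in> W" "W \<subseteq> fst c \<inter> fst c'"
    and d: "transition c c' differentiable at (snd c p)"
      "transition c' c'' differentiable at (snd c' p)"
  shows "frechet_derivative (transition c c'') (at (snd c p)) v =
    frechet_derivative (transition c' c'') (at (snd c' p)) (frechet_derivative (transition c c') (at (snd c p)) v)"
proof -
  have p: "p \<in> fst c" "p \<in> fst c'" using W by auto
  have d2: "transition c' c'' differentiable at (transition c c' (snd c p))"
    using d(2) transition_apply[OF inj(1) p(1)] by metis
  have "frechet_derivative (transition c c'') (at (snd c p)) =
    frechet_derivative (transition c' c'' \<circ> transition c c') (at (snd c p))"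
  proof (rule frechet_derivative_transform_within_open[symmetric, OF _ W(1)])
    show "transition c' c'' \<circ> transition c c' differentiable at (snd c p)"
      using d(1) d2 by (rule differentiable_chain_at)
    show "(transition c' c'' \<circ> transition c c') x = transition c c'' x" if "x \<in> snd c ` W" for x
      using that W(3) inj by (auto simp: transition_apply subset_iff)
  qed (use W in auto)
  then show ?thesis
    by (simp only: frechet_derivative_compose[OF d(1) d2] o_apply transition_apply[OF inj(1) p(1)])
qed

context
  fixes M :: "('a, 'e::euclidean_space) manifold"
  assumes M: "smooth_manifold M"
begin

lemma transition_differentiable:
  assumes "c \<in> charts_at M p" "c' \<in> charts_at M p"
  shows "transition c c' differentiable at (snd c p)"
  using smooth_on_imp_differentiable[OF smooth_transition[OF M]] assms unfolding charts_at_def by auto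

lemma linear_coord_vec:
  assumes c: "c \<in> charts_at M p"
  shows "linear (coord_vec M c p)"
proof (rule linearI)
  have l: "linear (frechet_derivative (transition c c') (at (snd c p)))" if "c' \<in> charts_at M p" for c'
    using linear_frechet_derivative transition_differentiable[OF c that] by blast
  show "coord_vec M c p (u + v) = coord_vec M c p u + coord_vec M c p v" for u v
    by (auto simp: coord_vec_def fun_eq_iff linear_add[OF l])
  show "coord_vec M c p (a *\<^sub>R v) = a *\<^sub>R coord_vec M c p v" for a v
    by (auto simp: coord_vec_def fun_eq_iff scaleR_fun_def linear_scale[OF l])
qed

lemma coord_vec_same:
  assumes c: "c \<in> charts_at M p"
  shows "coord_vec M c p e c = e"
  using c frechet_derivative_transition_self[OF chart_inj[OF M] chart_homeo(2)[OF M], of c p]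
  by (auto simp: coord_vec_def charts_at_def)

lemma transition_trans:
  assumes "c \<in> charts_at M p" "c' \<in> charts_at M p" "c'' \<in> charts_at M p"
  shows "frechet_derivative (transition c c'') (at (snd c p)) v =
    frechet_derivative (transition c' c'') (at (snd c' p)) (frechet_derivative (transition c c') (at (snd c p)) v)"
proof (rule frechet_derivative_transition_trans)
  have at: "c \<in> atlas M" "c' \<in> atlas M" "p \<in> fst c" "p \<in> fst c'"
    using assms by (auto simp: charts_at_def)
  show "inj_on (snd c) (fst c)" "inj_on (snd c') (fst c')"
    using chart_inj[OF M] at by auto
  show "open (snd c ` (fst c' \<inter> fst c))"
    using open_chart_image[OF M at(1) chart_homeo(1)[OF M at(2)]] .
qed (use assms in \<open>auto intro: transition_differentiable simp: charts_at_def\<close>)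

lemma coord_vec_tangent:
  assumes c: "c \<in> charts_at M p"
  shows "coord_vec M c p e \<in> tangent_space M p"
  unfolding tangent_space_def
proof (intro CollectI conjI ballI allI impI)
  fix d d' assume "d \<in> charts_at M p" "d' \<in> charts_at M p"
  then show "coord_vec M c p e d' = frechet_derivative (transition d d') (at (snd d p)) (coord_vec M c p e d)"
    using transition_trans[OF c, of d d' e] by (simp only: coord_vec_def if_True)
qed (simp add: coord_vec_def)

lemma tangent_eq_coord_vec:
  assumes c: "c \<in> charts_at M p" and v: "v \<in> tangent_space M p"
  shows "coord_vec M c p (v c) = v"
proof
  fix c'
  show "coord_vec M c p (v c) c' = v c'"
  proof (cases "c' \<in> charts_at M p")
    case True
    have "v c' = frechet_derivative (transition c c') (at (snd c p)) (v c)"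
      using v c True unfolding tangent_space_def by blast
    then show ?thesis unfolding coord_vec_def using True by (simp only: if_True)
  next
    case False
    then have "v c' = 0" using v unfolding tangent_space_def by blast
    then show ?thesis using False by (simp add: coord_vec_def)
  qed
qed

text \<open>With \<open>linear_coord_vec\<close> and \<open>inj_coord_vec\<close>: a chart identifies the tangent space with the model
  space.\<close>

lemma tangent_space_eq_range:
  assumes c: "c \<in> charts_at M p"
  shows "tangent_space M p = range (coord_vec M c p)"
proof
  show "tangent_space M p \<subseteq> range (coord_vec M c p)"
    using tangent_eq_coord_vec[OF c] by (metis rangeI subsetI)
qed (use coord_vec_tangent[OF c] in auto)

lemma inj_coord_vec:
  assumes c: "c \<in> charts_at M p"
  shows "inj (coord_vec M c p)"
  by (metis injI coord_vec_same[OF c])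

lemma subspace_tangent_space:
  assumes "p \<in> points M"
  shows "subspace (tangent_space M p)"
proof -
  obtain c where c: "c \<in> charts_at M p" using obtain_chart[OF M assms] .
  then show ?thesis
    unfolding tangent_space_eq_range[OF c] by (intro linear_subspace_image linear_coord_vec) auto
qed

end

locale immersed_submanifold =
  fixes Mb :: "('a, 'e::euclidean_space) manifold" and M :: "('a, 'f::euclidean_space) manifold"
  assumes Mb: "smooth_manifold Mb" and sub: "submanifold Mb M"
begin

lemma M: "smooth_manifold M"
  and points_subset: "points M \<subseteq> points Mb"
  and continuous_inclusion: "continuous_map (mtop M) (mtop Mb) id"
  using sub unfolding submanifold_def by auto

lemma smooth_inclusion:
  "c \<in> atlas M \<Longrightarrow> c' \<in> atlas Mb \<Longrightarrow> smooth_on (snd c ` (fst c \<inter> fst c')) (transition c c')"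
  using sub unfolding submanifold_def by auto

text \<open>The topology of the submanifold is at least as fine as the subspace topology, so domains of ambient charts
  trace out open sets.\<close>

lemma openin_ambient_chart:
  assumes "c' \<in> atlas Mb" "openin (mtop M) U"
  shows "openin (mtop M) (U \<inter> fst c')"
proof -
  have "openin (mtop M) {x \<in> points M. id x \<in> fst c'}"
    using openin_continuous_map_preimage[OF continuous_inclusion chart_homeo(1)[OF Mb assms(1)]] .
  moreover have "U \<inter> {x \<in> points M. id x \<in> fst c'} = U \<inter> fst c'"
    using openin_subset[OF assms(2)] by auto
  ultimately show ?thesis using openin_Int[OF assms(2)] by metis
qed

lemma inclusion_differentiable:
  assumes "c \<in> charts_at M p" "c' \<in> charts_at Mb p"
  shows "transition c c' differentiable at (snd c p)"
  using smooth_on_imp_differentiable[OF smooth_inclusion] assms unfolding charts_at_def by auto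

lemma linear_inclusion:
  assumes "c \<in> charts_at M p" "c' \<in> charts_at Mb p"
  shows "linear (frechet_derivative (transition c c') (at (snd c p)))"
  using linear_frechet_derivative inclusion_differentiable[OF assms] by blast

lemma inj_inclusion:
  assumes "c \<in> charts_at M p" "c' \<in> charts_at Mb p"
  shows "inj (frechet_derivative (transition c c') (at (snd c p)))"
  using sub assms unfolding submanifold_def charts_at_def by blast

lemma inclusion_trans_left:
  assumes "c \<in> charts_at M p" "c' \<in> charts_at M p" "c'' \<in> charts_at Mb p"
  shows "frechet_derivative (transition c c'') (at (snd c p)) v =
    frechet_derivative (transition c' c'') (at (snd c' p)) (frechet_derivative (transition c c') (at (snd c p)) v)"
proof (rule frechet_derivative_transition_trans)
  have at: "c \<in> atlas M" "c' \<in> atlas M" "p \<in> fst c" "p \<in> fst c'"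
    using assms by (auto simp: charts_at_def)
  show "inj_on (snd c) (fst c)" "inj_on (snd c') (fst c')"
    using chart_inj[OF M] at by auto
  show "open (snd c ` (fst c' \<inter> fst c))"
    using open_chart_image[OF M at(1) chart_homeo(1)[OF M at(2)]] .
qed (use assms in \<open>auto intro: transition_differentiable[OF M] inclusion_differentiable simp: charts_at_def\<close>)

lemma inclusion_trans_right:
  assumes "c \<in> charts_at M p" "c' \<in> charts_at Mb p" "c'' \<in> charts_at Mb p"
  shows "frechet_derivative (transition c c'') (at (snd c p)) v =
    frechet_derivative (transition c' c'') (at (snd c' p)) (frechet_derivative (transition c c') (at (snd c p)) v)"
proof (rule frechet_derivative_transition_trans)
  have at: "c \<in> atlas M" "c' \<in> atlas Mb" "p \<in> fst c" "p \<in> fst c'"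
    using assms by (auto simp: charts_at_def)
  show "inj_on (snd c) (fst c)" "inj_on (snd c') (fst c')"
    using chart_inj[OF M] chart_inj[OF Mb] at by auto
  show "open (snd c ` ((fst c \<inter> fst c') \<inter> fst c))"
    using open_chart_image[OF M at(1) openin_ambient_chart[OF at(2) chart_homeo(1)[OF M at(1)]]] .
qed (use assms in \<open>auto intro: transition_differentiable[OF Mb] inclusion_differentiable simp: charts_at_def\<close>)

text \<open>One pair of charts suffices. Membership in \<open>tangent_sub\<close> is a condition on all pairs of charts, and
  the two chain rules for the inclusion deduce it from the condition for a single pair.\<close>

lemma tangent_sub_parametrization:
  assumes p: "p \<in> points M"
  obtains \<psi> :: "'f \<Rightarrow> ('a, 'e) tvec" where "linear \<psi>" "inj \<psi>" "range \<psi> = tangent_sub Mb M p"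
proof -
  obtain c where c: "c \<in> charts_at M p" using obtain_chart[OF M p] .
  obtain c' where c': "c' \<in> charts_at Mb p" using obtain_chart[OF Mb] p points_subset by blast
  define L where "L = frechet_derivative (transition c c') (at (snd c p))"
  define \<psi> where "\<psi> = coord_vec Mb c' p \<circ> L"
  note L = linear_inclusion[OF c c', folded L_def] and injL = inj_inclusion[OF c c', folded L_def]
  have "linear \<psi>" unfolding \<psi>_def by (rule linear_compose[OF L linear_coord_vec[OF Mb c']])
  moreover have "inj \<psi>" unfolding \<psi>_def by (rule inj_compose[OF inj_coord_vec[OF Mb c'] injL])
  moreover have "range \<psi> = tangent_sub Mb M p"
  proof (intro equalityI subsetI)
    fix v assume "v \<in> range \<psi>"
    then obtain e where e: "v = coord_vec Mb c' p (L e)" unfolding \<psi>_def by auto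
    have "v d' = frechet_derivative (transition d d') (at (snd d p)) (coord_vec M c p e d)"
      if d: "d \<in> charts_at M p" "d' \<in> charts_at Mb p" for d d'
    proof -
      have "v d' = frechet_derivative (transition c d') (at (snd c p)) e"
        using inclusion_trans_right[OF c c' d(2), of e] d(2) by (simp add: e L_def coord_vec_def)
      also have "\<dots> = frechet_derivative (transition d d') (at (snd d p)) (coord_vec M c p e d)"
        using inclusion_trans_left[OF c d, of e] d(1) by (simp add: coord_vec_def)
      finally show ?thesis .
    qed
    then show "v \<in> tangent_sub Mb M p"
      unfolding tangent_sub_def using coord_vec_tangent[OF M c, of e] coord_vec_tangent[OF Mb c', of "L e"] e
      by blast
  next
    fix v assume "v \<in> tangent_sub Mb M p"
    then obtain u where "v \<in> tangent_space Mb p" "v c' = L (u c)"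
      unfolding tangent_sub_def L_def using c c' by blast
    then have "v = \<psi> (u c)"
      using tangent_eq_coord_vec[OF Mb c', of v] by (simp add: \<psi>_def)
    then show "v \<in> range \<psi>" by blast
  qed
  ultimately show thesis using that by blast
qed

lemma tangent_sub_subset: "tangent_sub Mb M p \<subseteq> tangent_space Mb p"
  unfolding tangent_sub_def by blast

lemma subspace_tangent_sub: "p \<in> points M \<Longrightarrow> subspace (tangent_sub Mb M p)"
  using tangent_sub_parametrization by (metis linear_subspace_image subspace_UNIV)

text \<open>This makes the natural-number subtraction in \<open>codimension\<close> exact.\<close>

lemma DIM_le: "DIM('f) \<le> DIM('e)"
proof -
  obtain p where p: "p \<in> points M" using points_nonempty[OF M] by blast
  obtain c where c: "c \<in> charts_at M p" using obtain_chart[OF M p] .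
  obtain c' where c': "c' \<in> charts_at Mb p" using obtain_chart[OF Mb] p points_subset by blast
  show ?thesis
    using dim_linear_image[OF linear_inclusion[OF c c'] inj_inclusion[OF c c'], of UNIV]
      dim_subset_UNIV[of "range (frechet_derivative (transition c c') (at (snd c p)))"]
    by simp
qed

end

section \<open>Subbundles along a submanifold\<close>

definition local_frame ::
    "('a, 'e::euclidean_space) manifold \<Rightarrow> ('a, 'f::euclidean_space) manifold \<Rightarrow> nat \<Rightarrow>
     ('a \<Rightarrow> ('a, 'e) tvec set) \<Rightarrow> 'a set \<Rightarrow> (nat \<Rightarrow> 'a \<Rightarrow> ('a, 'e) tvec) \<Rightarrow> bool"
  where "local_frame Mb M k E U s \<longleftrightarrow> openin (mtop M) U \<and>
    (\<forall>i<k. smooth_section_on Mb M U (s i)) \<and>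
    (\<forall>y\<in>U. inj_on (\<lambda>i. s i y) {..<k} \<and> independent ((\<lambda>i. s i y) ` {..<k}) \<and>
       span ((\<lambda>i. s i y) ` {..<k}) = E y)"

lemma subbundle_iff_local_frame:
  "subbundle Mb M k E \<longleftrightarrow> (\<forall>x\<in>points M. \<exists>U s. x \<in> U \<and> local_frame Mb M k E U s)"
  unfolding subbundle_def local_frame_def
  by (intro ball_cong arg_cong[where f = Ex] ext refl) (simp only: conj_ac)

lemma subbundle_dim:
  assumes "subbundle Mb M k E" "x \<in> points M"
  shows "dim (E x) = k" "subspace (E x)"
proof -
  obtain U s where "x \<in> U" "local_frame Mb M k E U s"
    using assms unfolding subbundle_iff_local_frame by blast
  then have s: "inj_on (\<lambda>i. s i x) {..<k}" "independent ((\<lambda>i. s i x) ` {..<k})"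
       "span ((\<lambda>i. s i x) ` {..<k}) = E x"
    unfolding local_frame_def by simp_all
  show "dim (E x) = k"
    using real_vector.dim_span_eq_card_independent[OF s(2)] card_image[OF s(1)] s(3) by simp
  show "subspace (E x)" using s(3) subspace_span by metis
qed

lemma subbundle_cong:
  assumes "subbundle Mb M k E" "\<And>x. x \<in> points M \<Longrightarrow> E x = F x"
  shows "subbundle Mb M k F"
proof -
  have "local_frame Mb M k F U s" if frame: "local_frame Mb M k E U s" for U s
  proof -
    have "E y = F y" if "y \<in> U" for y
      using assms(2) that frame openin_subset unfolding local_frame_def by blast
    then show ?thesis using frame unfolding local_frame_def by simp
  qed
  then show ?thesis using assms(1) unfolding subbundle_iff_local_frame by meson
qed

lemma distribution_cong:
  assumes "distribution Mb M k E" "\<And>x. x \<in> points M \<Longrightarrow> E x = F x"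
  shows "distribution Mb M k F"
  unfolding distribution_def
proof
  show "subbundle Mb M k F"
    using assms(1) subbundle_cong[of Mb M k E F] assms(2) unfolding distribution_def by simp
  show "\<forall>x\<in>points M. F x \<subseteq> tangent_sub Mb M x"
    using assms unfolding distribution_def by simp
qed

text \<open>An endomorphism field is linear only on the tangent space. Precomposing it with the projection
  that recovers a tangent vector from its component in one chart gives a map that is linear on all
  chart-indexed families, to which general results on linear maps apply.\<close>

lemma smooth_endomorphism_field_linear_extension:
  assumes Mb: "smooth_manifold Mb" and J: "smooth_endomorphism_field Mb J" and p: "p \<in> points Mb"
  obtains L where "linear L" "\<And>v. v \<in> tangent_space Mb p \<Longrightarrow> L v = J p v"
proof -
  obtain c where c: "c \<in> charts_at Mb p" using obtain_chart[OF Mb p] .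
  define \<pi> where "\<pi> v = coord_vec Mb c p (v c)" for v
  have \<pi>: "linear \<pi>"
    by (rule linearI) (auto simp: \<pi>_def scaleR_fun_def linear_add[OF linear_coord_vec[OF Mb c]]
      linear_scale[OF linear_coord_vec[OF Mb c]])
  have T: "\<pi> v \<in> tangent_space Mb p" for v
    unfolding \<pi>_def by (rule coord_vec_tangent[OF Mb c])
  have "linear (\<lambda>v. J p (\<pi> v))"
    by (rule linearI) (use J p T in \<open>auto simp: linear_add[OF \<pi>] linear_scale[OF \<pi>] smooth_endomorphism_field_def\<close>)
  moreover have "J p (\<pi> v) = J p v" if "v \<in> tangent_space Mb p" for v
    using tangent_eq_coord_vec[OF Mb c that] by (simp add: \<pi>_def)
  ultimately show thesis using that by blast
qed

context immersed_submanifold begin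

text \<open>In an ambient chart the components of \<open>J x (s x)\<close> are the sums over the standard basis of the
  components of \<open>s\<close> times those of \<open>J\<close>. The former are smooth in the coordinates of the submanifold by
  assumption, the latter in the coordinates of the ambient manifold; composing with the coordinate
  expression of the inclusion brings both to the same domain.\<close>

lemma smooth_section_endomorphism:
  assumes J: "smooth_endomorphism_field Mb J"
    and U: "openin (mtop M) U" and s: "smooth_section_on Mb M U s"
  shows "smooth_section_on Mb M U (\<lambda>x. J x (s x))"
  unfolding smooth_section_on_def
proof (intro conjI ballI)
  have UM: "x \<in> points Mb" if "x \<in> U" for x using U openin_subset points_subset that by blast
  have sT: "s x \<in> tangent_space Mb x" if "x \<in> U" for x
    using s that unfolding smooth_section_on_def by blast
  show "J x (s x) \<in> tangent_space Mb x" if "x \<in> U" for x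
    using sT[OF that] UM[OF that] J unfolding smooth_endomorphism_field_def by blast
  fix c :: "('a, 'f) chart" and c' :: "('a, 'e) chart"
  assume c: "c \<in> atlas M" and c': "c' \<in> atlas Mb"
  define S where "S = snd c ` (U \<inter> fst c \<inter> fst c')"
  have S: "open S"
    using open_chart_image[OF M c openin_ambient_chart[OF c' U]] unfolding S_def
    by (simp add: Int_ac)
  let ?i = "inv_into (fst c) (snd c)"
  \<comment> \<open>\<open>G e\<close> is the image of the coordinate vector field \<open>e\<close> in ambient coordinates.\<close>
  define G where "G e y = (let p = inv_into (fst c') (snd c') y in J p (coord_vec Mb c' p e) c')" for e y
  have eq: "(\<Sum>e\<in>Basis. (s (?i y) c' \<bullet> e) *\<^sub>R G e (transition c c' y)) = J (?i y) (s (?i y)) c'"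
    if y: "y \<in> S" for y
  proof -
    obtain p where p: "p \<in> U" "p \<in> fst c" "p \<in> fst c'" "y = snd c p" using y unfolding S_def by blast
    have iy: "?i y = p" using p chart_inj[OF M c] by simp
    have ip: "inv_into (fst c') (snd c') (transition c c' y) = p"
      using p chart_inj[OF M c] chart_inj[OF Mb c'] by (simp add: transition_apply)
    have at: "c' \<in> charts_at Mb p" using p c' by (simp add: charts_at_def)
    obtain L where L: "linear L" "\<And>v. v \<in> tangent_space Mb p \<Longrightarrow> L v = J p v"
      using smooth_endomorphism_field_linear_extension[OF Mb J UM[OF p(1)]] by blast
    have "s p = coord_vec Mb c' p (\<Sum>e\<in>Basis. (s p c' \<bullet> e) *\<^sub>R e)"
      using tangent_eq_coord_vec[OF Mb at sT[OF p(1)]] by (simp add: euclidean_representation)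
    also have "\<dots> = (\<Sum>e\<in>Basis. (s p c' \<bullet> e) *\<^sub>R coord_vec Mb c' p e)"
      by (simp add: linear_sum[OF linear_coord_vec[OF Mb at]] linear_scale[OF linear_coord_vec[OF Mb at]])
    finally have sp: "s p = (\<Sum>e\<in>Basis. (s p c' \<bullet> e) *\<^sub>R coord_vec Mb c' p e)" .
    have "J p (s p) = L (s p)" using L(2)[OF sT[OF p(1)]] by simp
    also have "\<dots> = (\<Sum>e\<in>Basis. (s p c' \<bullet> e) *\<^sub>R L (coord_vec Mb c' p e))"
      by (subst sp) (simp add: linear_sum[OF L(1)] linear_scale[OF L(1)])
    also have "\<dots> = (\<Sum>e\<in>Basis. (s p c' \<bullet> e) *\<^sub>R J p (coord_vec Mb c' p e))"
      using L(2)[OF coord_vec_tangent[OF Mb at]] by simp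
    finally have "J p (s p) = (\<Sum>e\<in>Basis. (s p c' \<bullet> e) *\<^sub>R J p (coord_vec Mb c' p e))" .
    moreover have "(\<Sum>e\<in>A. h e) c' = (\<Sum>e\<in>A. h e c')" for A and h :: "'e \<Rightarrow> ('a, 'e) tvec"
      by (induction A rule: infinite_finite_induct) auto
    ultimately show ?thesis
      by (simp add: iy ip G_def scaleR_fun_def)
  qed
  have "Ck_on k S (\<lambda>y. J (?i y) (s (?i y)) c')" for k
  proof (rule Ck_on_cong[OF S _ eq])
    have 1: "Ck_on k S (\<lambda>y. s (?i y) c')"
      using s c c' unfolding smooth_section_on_def smooth_on_def S_def by blast
    have 2: "Ck_on k (snd c' ` fst c') (G e)" for e
      using J c' unfolding smooth_endomorphism_field_def smooth_on_def G_def by blast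
    have 3: "Ck_on k S (transition c c')"
      using smooth_inclusion[OF c c'] Ck_on_subset[of k "snd c ` (fst c \<inter> fst c')" _ S]
      unfolding smooth_on_def S_def by blast
    have 4: "transition c c' ` S \<subseteq> snd c' ` fst c'"
      using chart_inj[OF M c] by (auto simp: S_def transition_apply)
    show "Ck_on k S (\<lambda>y. \<Sum>e\<in>Basis. (s (?i y) c' \<bullet> e) *\<^sub>R G e (transition c c' y))"
      by (intro Ck_on_sum Ck_on_scaleR S Ck_on_compose[OF S 3 2 4]
        Ck_on_bounded_linear[OF S bounded_linear_inner_left 1]) auto
  qed
  then show "smooth_on (snd c ` (U \<inter> fst c \<inter> fst c')) (\<lambda>y. J (?i y) (s (?i y)) c')"
    unfolding smooth_on_def S_def by blast
qed

lemma subbundle_image_endomorphism: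
  assumes J: "smooth_endomorphism_field Mb J"
    and inj: "\<And>p. p \<in> points Mb \<Longrightarrow> inj_on (J p) (tangent_space Mb p)"
    and E: "subbundle Mb M k E"
  shows "subbundle Mb M k (\<lambda>x. J x ` E x)"
proof -
  have "local_frame Mb M k (\<lambda>x. J x ` E x) U (\<lambda>i x. J x (s i x))" if frame: "local_frame Mb M k E U s" for U s
  proof -
    have U: "openin (mtop M) U" and s: "\<And>i. i < k \<Longrightarrow> smooth_section_on Mb M U (s i)"
      using frame unfolding local_frame_def by simp_all
    have fr: "inj_on (\<lambda>i. s i y) {..<k}" "independent ((\<lambda>i. s i y) ` {..<k})"
         "span ((\<lambda>i. s i y) ` {..<k}) = E y" if "y \<in> U" for y
      using frame that unfolding local_frame_def by simp_all
    have "inj_on (\<lambda>i. J y (s i y)) {..<k} \<and> independent ((\<lambda>i. J y (s i y)) ` {..<k}) \<and>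
         span ((\<lambda>i. J y (s i y)) ` {..<k}) = J y ` E y" if y: "y \<in> U" for y
    proof -
      have yM: "y \<in> points Mb" using y U openin_subset points_subset by blast
      obtain L where L: "linear L" "\<And>v. v \<in> tangent_space Mb y \<Longrightarrow> L v = J y v"
        using smooth_endomorphism_field_linear_extension[OF Mb J yM] by blast
      have sT: "s i y \<in> tangent_space Mb y" if "i < k" for i
        using s[OF that] y unfolding smooth_section_on_def by blast
      then have "span ((\<lambda>i. s i y) ` {..<k}) \<subseteq> tangent_space Mb y"
        by (intro span_minimal subspace_tangent_space[OF Mb yM]) auto
      then have ET: "E y \<subseteq> tangent_space Mb y" using fr[OF y] by simp
      have injL: "inj_on L (span ((\<lambda>i. s i y) ` {..<k}))"
        using inj[OF yM] ET fr[OF y] L(2) unfolding inj_on_def by (metis subsetD)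
      have im: "(\<lambda>i. J y (s i y)) ` {..<k} = L ` ((\<lambda>i. s i y) ` {..<k})"
        using L(2)[OF sT] by (force simp: image_image)
      have "independent ((\<lambda>i. J y (s i y)) ` {..<k})"
        unfolding im using linear_independent_injective_image[OF L(1) fr(2)[OF y] injL] .
      moreover have "span ((\<lambda>i. J y (s i y)) ` {..<k}) = J y ` E y"
        unfolding im using linear_span_image[OF L(1)] fr[OF y] L(2) ET by (metis image_cong subsetD)
      moreover have "inj_on (\<lambda>i. J y (s i y)) {..<k}"
        using inj[OF yM] fr[OF y] sT unfolding inj_on_def by (metis lessThan_iff)
      ultimately show ?thesis by blast
    qed
    then show ?thesis unfolding local_frame_def using U smooth_section_endomorphism[OF J U s] by simp
  qed
  then show ?thesis using E unfolding subbundle_iff_local_frame by meson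
qed

end

section \<open>The two implications\<close>

locale norden_submanifold = immersed_submanifold Mb M
  for Mb :: "('a, 'e::euclidean_space) manifold" and M :: "('a, 'f::euclidean_space) manifold" +
  fixes J :: "'a \<Rightarrow> ('a, 'e) tvec \<Rightarrow> ('a, 'e) tvec"
    and g :: "'a \<Rightarrow> ('a, 'e) tvec \<Rightarrow> ('a, 'e) tvec \<Rightarrow> real"
  assumes norden: "norden_manifold Mb J g"
begin

abbreviation (input) g_tilde where "g_tilde \<equiv> associated_metric J g"
abbreviation (input) T where "T \<equiv> tangent_sub Mb M"

lemma smooth_J: "smooth_endomorphism_field Mb J"
  using norden unfolding norden_manifold_def almost_complex_structure_def by blast

lemma norden_space_at:
  assumes "p \<in> points Mb"
  shows "norden_space (tangent_space Mb p) (J p) (g p)"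
proof
  show "subspace (tangent_space Mb p)" using subspace_tangent_space[OF Mb assms] .
qed (use norden assms in \<open>auto simp: norden_manifold_def almost_complex_structure_def
    pseudo_Riemannian_metric_def smooth_endomorphism_field_def smooth_symmetric_form_field_def\<close>)

lemma inj_on_J:
  assumes "p \<in> points Mb"
  shows "inj_on (J p) (tangent_space Mb p)"
  using norden_space.J_J[OF norden_space_at[OF assms]] by (metis inj_onI neg_equal_iff_equal)

lemma orthogonal_space_eq_perp:
  "p \<in> points Mb \<Longrightarrow> orthogonal_space Mb g p E = norden_space.perp (tangent_space Mb p) (g p) E"
  by (simp add: orthogonal_space_def norden_space.perp_def[OF norden_space_at])

lemma orthogonal_space_eq_perp_tilde:
  "p \<in> points Mb \<Longrightarrow>
    orthogonal_space Mb g_tilde p E = norden_space.perp_tilde (tangent_space Mb p) (J p) (g p) E"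
  by (simp add: orthogonal_space_def associated_metric_def norden_space.perp_tilde_def[OF norden_space_at])

text \<open>Used to convert between \<open>codimension Mb M < DIM('f)\<close>, which is part of coisotropy, and positivity
  of the rank of \<open>D\<close>, respectively of the screen distribution.\<close>

lemma dim_tangent_sub_add:
  assumes "x \<in> points M" "subspace E" "subspace F" "complementary_in (T x) E F"
  shows "dim E + dim F = DIM('f)"
proof -
  obtain \<psi> :: "'f \<Rightarrow> ('a, 'e) tvec" where \<psi>: "linear \<psi>" "inj \<psi>" "range \<psi> = T x"
    using tangent_sub_parametrization[OF assms(1)] .
  show ?thesis
    using complementary_in_range_iff_dim[OF \<psi>(1,2), of E F] complementary_in_subset[OF assms(4,2,3)]
      assms \<psi>(3) unfolding complementary_in_def by auto
qed

text \<open>The dimension count common to both implications; \<open>F\<close> will be the image of the radical under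
  \<open>J\<close>.\<close>

lemma complementary_to_tangent_sub:
  assumes x: "x \<in> points M" and F: "subspace F" "F \<subseteq> tangent_space Mb x" "T x \<inter> F = {0}"
    and dim: "dim F = codimension Mb M"
  shows "{u + v | u v. u \<in> T x \<and> v \<in> F} = tangent_space Mb x"
proof -
  obtain \<psi> :: "'f \<Rightarrow> ('a, 'e) tvec" where \<psi>: "linear \<psi>" "inj \<psi>" "range \<psi> = T x"
    using tangent_sub_parametrization[OF x] .
  have "dim (T x) = DIM('f)" using dim_linear_image[OF \<psi>(1,2), of UNIV] \<psi>(3) by simp
  then have "dim (T x) + dim F = DIM('e)" using dim DIM_le unfolding codimension_def by simp
  moreover obtain c where c: "c \<in> charts_at Mb x" using obtain_chart[OF Mb] x points_subset by blast
  ultimately have "complementary_in (tangent_space Mb x) (T x) F"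
    using complementary_in_range_iff_dim[OF linear_coord_vec[OF Mb c] inj_coord_vec[OF Mb c]
        subspace_tangent_sub[OF x] _ F(1) _ F(3)] F(2) tangent_sub_subset[of x]
    by (simp add: tangent_space_eq_range[OF Mb c])
  then show ?thesis unfolding complementary_in_def by (rule conjunct2)
qed

text \<open>The screen is \<open>D\<close> and the lightlike transversal bundle is \<open>J D'\<close>. The latter is totally null because
  for \<open>w \<in> D'\<close> and a normal vector \<open>v\<close> the associated product of \<open>J w\<close> and \<open>v\<close> is \<open>- g w v\<close>.\<close>

lemma generic_imp_coisotropic_radical_transversal:
  assumes "generic_submanifold Mb J g M"
  shows "coisotropic_radical_transversal Mb J g_tilde M"
proof -
  obtain D D' where CR: "CR_distributions Mb J g M D D'"
    and codim: "\<And>x. x \<in> points M \<Longrightarrow> dim (D' x) = codimension Mb M"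
    using assms unfolding generic_submanifold_def by blast
  obtain k k' where k: "k > 0" "distribution Mb M k D" and k': "k' > 0" "distribution Mb M k' D'"
    using CR unfolding CR_distributions_def by blast
  have D: "subbundle Mb M k D" and D': "subbundle Mb M k' D'"
    using k k' unfolding distribution_def by blast+
  have N: "subbundle Mb M k' (\<lambda>x. J x ` D' x)"
    using subbundle_image_endomorphism[OF smooth_J inj_on_J D'] .
  obtain x0 where x0: "x0 \<in> points M" using points_nonempty[OF M] by blast
  \<comment> \<open>Genericity speaks about fibres; comparing with the rank needs one point.\<close>
  have k'_eq: "k' = codimension Mb M" using codim[OF x0] subbundle_dim[OF D' x0] by simp
  have point: "radical Mb g_tilde M x = D' x"
    "complementary_in (orthogonal_space Mb g_tilde x (D x)) (D' x) (J x ` D' x)"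
    "\<forall>u\<in>J x ` D' x. \<forall>v\<in>J x ` D' x. g_tilde x u v = 0"
    "complementary_in (T x) (D' x) (D x)" "J x ` D x = D x" if x: "x \<in> points M" for x
  proof -
    have xb: "x \<in> points Mb" using x points_subset by blast
    interpret X: norden_space "tangent_space Mb x" "J x" "g x" using norden_space_at[OF xb] .
    note subD = subbundle_dim(2)[OF D x] subbundle_dim(2)[OF D' x]
    note subT = subspace_tangent_sub[OF x] tangent_sub_subset
    have nd: "nondegenerate_on (g x) (T x)" and c: "complementary_in (T x) (D x) (D' x)"
      and orth: "\<And>u v. u \<in> D x \<Longrightarrow> v \<in> D' x \<Longrightarrow> g x u v = 0" and JD: "J x ` D x = D x"
      and JD': "J x ` D' x \<subseteq> X.perp (T x)"
      using CR[unfolded CR_distributions_def, THEN conjunct2, THEN conjunct2, THEN bspec, OF x]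
      unfolding orthogonal_space_eq_perp[OF xb] by simp_all
    show rad: "radical Mb g_tilde M x = D' x"
      using X.CR_radical[OF subT nd c JD JD' subD]
      by (simp add: radical_def orthogonal_space_eq_perp_tilde[OF xb])
    have N_x: "subspace (J x ` D' x)" "dim (J x ` D' x) = codimension Mb M"
      using subbundle_dim[OF N x] k'_eq by simp_all
    have 0: "T x \<inter> J x ` D' x = {0}"
    proof
      show "T x \<inter> J x ` D' x \<subseteq> {0}"
      proof
        fix v assume v: "v \<in> T x \<inter> J x ` D' x"
        then have "v \<in> X.perp (T x)" using JD' by auto
        then show "v \<in> {0}" using nd v unfolding nondegenerate_on_def X.perp_def by auto
      qed
    qed (use subspace_0[OF subT(1)] subspace_0[OF N_x(1)] in auto)
    have "J x ` D' x \<subseteq> tangent_space Mb x" using JD' unfolding X.perp_def by auto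
    from X.CR_transversal_complement[OF subT nd c orth JD JD' subD complementary_to_tangent_sub[OF x N_x(1) this 0 N_x(2)]]
    show "complementary_in (orthogonal_space Mb g_tilde x (D x)) (D' x) (J x ` D' x)"
      by (simp add: orthogonal_space_eq_perp_tilde[OF xb])
    show "\<forall>u\<in>J x ` D' x. \<forall>v\<in>J x ` D' x. g_tilde x u v = 0"
    proof (intro ballI)
      fix u v assume u: "u \<in> J x ` D' x" and v: "v \<in> J x ` D' x"
      obtain w where w: "w \<in> D' x" "u = J x w" using u by blast
      have wT: "w \<in> T x" using complementary_in_subset[OF c subD] w by blast
      then have wV: "w \<in> tangent_space Mb x" using subT by blast
      have vp: "v \<in> X.perp (T x)" using JD' v by blast
      then have "g x v w = 0" "v \<in> tangent_space Mb x" using wT unfolding X.perp_def by blast+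
      then show "g_tilde x u v = 0"
        using wV w(2) X.g_minus[of w v] X.g_sym[of v w] X.J_J by (simp add: associated_metric_def)
    qed
    show "complementary_in (T x) (D' x) (D x)" "J x ` D x = D x"
      using c JD complementary_in_commute by blast+
  qed
  have "DIM('f) = k + k'"
    using dim_tangent_sub_add[OF x0 _ _ point(4)[OF x0]] subbundle_dim[OF D x0] subbundle_dim[OF D' x0]
    by simp
  then have "coisotropic Mb g_tilde M"
    unfolding coisotropic_def lightlike_submanifold_def
    using k k' k'_eq distribution_cong[OF k'(2), of "radical Mb g_tilde M"] point(1) by simp
  moreover have "screen_distribution Mb g_tilde M D"
    unfolding screen_distribution_def using k(2) point(1,4) by auto
  moreover have "lightlike_transversal_bundle Mb g_tilde M D (\<lambda>x. J x ` D' x)"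
    unfolding lightlike_transversal_bundle_def using N point(1,2,3) by auto
  moreover have "\<forall>x\<in>points M. J x ` radical Mb g_tilde M x = J x ` D' x \<and> J x ` D x = D x"
    using point(1,5) by simp
  ultimately show ?thesis
    unfolding coisotropic_radical_transversal_def by blast
qed

text \<open>Here \<open>D\<close> is the screen and \<open>D'\<close> the radical, so smoothness and the rank condition of genericity
  are part of the hypothesis. The rank of \<open>J R\<close>, needed for the dimension count, is obtained by moving a
  frame of the radical with \<open>J\<close>, since a lightlike transversal bundle may have any rank by definition.\<close>

lemma coisotropic_radical_transversal_imp_generic:
  assumes "coisotropic_radical_transversal Mb J g_tilde M"
  shows "generic_submanifold Mb J g M"
proof -
  define R where "R = radical Mb g_tilde M"
  obtain S N where screen: "screen_distribution Mb g_tilde M S"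
    and ltr: "lightlike_transversal_bundle Mb g_tilde M S N"
    and JR: "\<And>x. x \<in> points M \<Longrightarrow> J x ` R x = N x" and JS: "\<And>x. x \<in> points M \<Longrightarrow> J x ` S x = S x"
    and coiso: "coisotropic Mb g_tilde M"
    using assms unfolding coisotropic_radical_transversal_def R_def by auto
  obtain k where k: "distribution Mb M k S" using screen unfolding screen_distribution_def by blast
  have R: "distribution Mb M (codimension Mb M) R" and pos: "codimension Mb M > 0"
    and less: "codimension Mb M < DIM('f)"
    using coiso unfolding coisotropic_def lightlike_submanifold_def R_def by blast+
  have subS: "subbundle Mb M k S" and subR: "subbundle Mb M (codimension Mb M) R"
    using k R unfolding distribution_def by blast+
  have subN: "subbundle Mb M (codimension Mb M) (\<lambda>x. J x ` R x)"
    using subbundle_image_endomorphism[OF smooth_J inj_on_J subR] .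
  have compl: "complementary_in (T x) (R x) (S x)" if "x \<in> points M" for x
    using screen that unfolding screen_distribution_def R_def by blast
  obtain x0 where x0: "x0 \<in> points M" using points_nonempty[OF M] by blast
  have "codimension Mb M + k = DIM('f)"
    using dim_tangent_sub_add[OF x0 _ _ compl[OF x0]] subbundle_dim[OF subS x0] subbundle_dim[OF subR x0]
    by simp
  then have "k > 0" using less by simp
  moreover have "nondegenerate_on (g x) (T x) \<and> complementary_in (T x) (S x) (R x) \<and>
       (\<forall>u\<in>S x. \<forall>v\<in>R x. g x u v = 0) \<and> J x ` S x = S x \<and> J x ` R x \<subseteq> normal_space Mb g M x"
    if x: "x \<in> points M" for x
  proof -
    have xb: "x \<in> points Mb" using x points_subset by blast
    interpret X: norden_space "tangent_space Mb x" "J x" "g x" using norden_space_at[OF xb] .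
    note subT = subspace_tangent_sub[OF x] tangent_sub_subset
    note subs = subbundle_dim(2)[OF subR x] subbundle_dim(2)[OF subS x]
    have Rx: "R x = T x \<inter> X.perp_tilde (T x)"
      by (simp add: R_def radical_def orthogonal_space_eq_perp_tilde[OF xb])
    have Nx: "complementary_in (X.perp_tilde (S x)) (R x) (J x ` R x)"
      using ltr[unfolded lightlike_transversal_bundle_def, THEN conjunct2, THEN bspec, OF x]
      unfolding JR[OF x, unfolded R_def] R_def orthogonal_space_eq_perp_tilde[OF xb] by blast
    have 0: "T x \<inter> J x ` R x = {0}"
      using X.radical_transversal_Int[OF subT Rx subs(2) compl[OF x] Nx
        subspace_0[OF subbundle_dim(2)[OF subN x]]] .
    have JRp: "J x ` R x \<subseteq> X.perp (T x)"
      unfolding Rx X.perp_tilde_eq_vimage by blast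
    then have "J x ` R x \<subseteq> tangent_space Mb x" unfolding X.perp_def by auto
    from X.radical_transversal_nondegenerate[OF subT Rx subs(2) compl[OF x] JS[OF x]
        complementary_to_tangent_sub[OF x subbundle_dim(2)[OF subN x] this 0 subbundle_dim(1)[OF subN x]]]
    have "nondegenerate_on (g x) (T x)" .
    moreover have "\<forall>u\<in>S x. \<forall>v\<in>R x. g x u v = 0"
      using X.radical_transversal_orthogonal[OF subT(2) Rx complementary_in_subset(2)[OF compl[OF x] subs] JS[OF x]]
      by blast
    ultimately show ?thesis
      using JS[OF x] compl[OF x] JRp complementary_in_commute unfolding orthogonal_space_eq_perp[OF xb] by blast
  qed
  ultimately have "CR_distributions Mb J g M S R"
    unfolding CR_distributions_def using k R pos by blast
  then show ?thesis
    unfolding generic_submanifold_def using subbundle_dim(1)[OF subR] by blast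
qed

end

theorem corollary3p1:
  fixes Mb :: "('a, 'e::euclidean_space) manifold"
    and M :: "('a, 'f::euclidean_space) manifold"
    and J :: "'a \<Rightarrow> ('a, 'e) tvec \<Rightarrow> ('a, 'e) tvec"
    and g :: "'a \<Rightarrow> ('a, 'e) tvec \<Rightarrow> ('a, 'e) tvec \<Rightarrow> real"
    and n m :: nat
  assumes "DIM('e) = 2 * n" and "DIM('f) = m"
    and "norden_manifold Mb J g"
    and "submanifold Mb M"
  shows "generic_submanifold Mb J g M \<longleftrightarrow>
    coisotropic_radical_transversal Mb J (associated_metric J g) M"
proof -
  interpret norden_submanifold Mb M J g
    by unfold_locales (use assms in \<open>auto simp: norden_manifold_def\<close>)
  show ?thesis
    using generic_imp_coisotropic_radical_transversal coisotropic_radical_transversal_imp_generic by blast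
qed

end
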